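(* Let $\mathsf{TM}=(\mathcal A,b,Q,q_0,\delta,Q_{\mathrm{accept}},Q_{\mathrm{reject}})$ be any single-tape Turing machine, and for a nonempty input $x\in(\mathcal A\setminus\{b\})^*$ on which $\mathsf{TM}$ halts let $T(x)$ and $S(x)$ be its running time and space on $x$. There exists a (fixed, finite-size) decoder-only transformer with constant depth, constant embedding dimension, Gated ReLU activation $(u,v)\mapsto u\max(v,0)$, positional embedding $n\mapsto n$ and average-hard attention, over the vocabulary $\Sigma=(Q\times\mathcal A\times\{-1,0,1\})\cup\{[\mathrm{SEP}],[\mathrm{RETURN}]\}$, with next-token predictor $\pi_\theta:\Sigma^*\to\Sigma$, such that for every nonempty input $x\in(\mathcal A\setminus\{b\})^*$ on which $\mathsf{TM}$ halts, the process $\mathrm{PENCIL}_{f_{\pi_\theta},\phi'}$ started from the prompt encoding $x$ satisfies: 1. it halts and produces the same output (accept or reject) as $\mathsf{TM}$ on $x$; 2. the total number of tokens it generates is $\mathcal O(T(x))$; 3. the maximal context length used during generation is $\mathcal O(S(x))$. The constants hidden in $\mathcal O(\cdot)$ do not depend on $x$.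
   Context: **Turing machine.** $\mathcal A$ is a finite tape alphabet, $b\in\mathcal A$ the blank, $Q$ a finite set of control states, $q_0\in Q$ initial, $\delta:Q\times\mathcal A\to Q\times(\mathcal A\setminus\{b\})\times\{-1,0,1\}$, and $Q_{\mathrm{accept}},Q_{\mathrm{reject}}\subseteq Q$ are disjoint. The tape is two-way infinite, cells indexed by $\mathbb Z$. On input $x=(x_1,\dots,x_n)$, cells $0,\dots,n-1$ contain $x_1,\dots,x_n$, all other cells contain $b$, the head is at position $n$ and the control state is $q_0$. In each step with control state $q$ and scanned symbol $a$, $(q',a',d')=\delta(q,a)$ is computed; $a'$ is written at the current head position, the head moves by $d'$, and the control state becomes $q'$. The machine halts at the first step $t\ge1$ after which the control state lies in $Q_{\mathrm{accept}}\cup Q_{\mathrm{reject}}$; it accepts or rejects accordingly. $T(x)$ is the number of steps until halting and $S(x)$ is the number of tape cells that initially contain an input symbol or are at some time the head position. **Transformer.** Sequences are nonempty. For $v\in\mathbb R^m$, $\mathrm{hardmax}(v)$ is the uniform probability vector on $\arg\max_j v_j$ (average-hard attention). A transformer over vocabulary $\Sigma$ with parameters $d,d_{SA},d_{FF},H,L\in\mathbb N^+$ and real weights acts on $x=(x_1,\dots,x_n)\in\Sigma^n$ as follows. Initial embeddings: $h^{(0)}_i=\theta_{TE}(x_i)+\theta_{PE}\cdot i\in\mathbb R^d$, where $\theta_{TE}:\Sigma\to\mathbb R^d$ and $\theta_{PE}\in\mathbb R^{d}$ (positional embedding $n\mapsto n$). Layer $\ell=1,\dots,L$ (with its own weights,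 superscript $\ell$ suppressed): $u_i=h_i^{(\ell-1)}+\sum_{r=1}^H (W_O^r)^\top\sum_{j\le i}\alpha^r_{ij}W_V^rh_j^{(\ell-1)}$ with $\alpha^r_i=\mathrm{hardmax}\big((W_Q^rh^{(\ell-1)}_i\cdot W_K^rh^{(\ell-1)}_j)_{j\le i}\big)$ and $W_Q^r,W_K^r,W_V^r,W_O^r\in\mathbb R^{d_{SA}\times d}$; then $h_i^{(\ell)}=u_i+W_0^\top\big((W_1u_i)\odot\max(W_2u_i,0)\big)$ with $W_0,W_1,W_2\in\mathbb R^{d_{FF}\times d}$ ($\odot$ entrywise product, $\max$ entrywise). Next token: $\pi_\theta(x)=\arg\max_{a\in\Sigma}[\theta_{DEC}h_n^{(L)}]_a$ with $\theta_{DEC}\in\mathbb R^{|\Sigma|\times d}$, the maximum being required to be unique on the sequences encountered. All computations are over exact reals. **PENCIL with the simplified reduction rule.** $f_{\pi_\theta}(y)=(y,\pi_\theta(y))$ appends the next token. The reduction rule $\phi':\Sigma^*\to\Sigma^*$ is: if $y=(\mathbf T,[\mathrm{SEP}],\mathbf T',[\mathrm{RETURN}])$ where $\mathbf T'$ contains neither $[\mathrm{SEP}]$ nor $[\mathrm{RETURN}]$, then $\phi'(y)=\mathbf T'$; otherwise $\phi'(y)=y$. $\mathrm{PENCIL}_{f_{\pi_\theta},\phi'}$ started from prompt $y_0$ produces $y_{j+1}=\phi'(f_{\pi_\theta}(y_j))$, one generated token per step. It halts as soon as a generated token is of the form $(q,a,d)$ with $q\in Q_{\mathrm{accept}}$ (output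 accept) or $q\in Q_{\mathrm{reject}}$ (output reject). The number of generated tokens is the number of steps until halting, and the maximal context length is the maximum of the lengths $|y_0|$ and $|f_{\pi_\theta}(y_j)|$ over all steps performed. The prompt encoding $x=(x_1,\dots,x_n)$ is $y_0=\big((q_0,x_1,+1),\dots,(q_0,x_n,+1)\big)$. *)

theory Defs
  imports Complex_Main
begin

section \<open>Turing machines\<close>

datatype move = MoveLeft | Stay | MoveRight

primrec offset :: "move \<Rightarrow> int" where
  "offset MoveLeft = -1"
| "offset Stay = 0"
| "offset MoveRight = 1"

text \<open>The tape alphabet and the set of control states are the (finite) types \<open>'a\<close> and \<open>'q\<close>.\<close>

record ('q, 'a) tm =
  blank :: 'a
  q0 :: 'q
  delta :: "'q \<times> 'a \<Rightarrow> 'q \<times> 'a \<times> move"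
  Q_accept :: "'q set"
  Q_reject :: "'q set"

definition turing_machine :: "('q, 'a) tm \<Rightarrow> bool" where
  "turing_machine M \<longleftrightarrow>
     (\<forall>q a q' a' m. delta M (q, a) = (q', a', m) \<longrightarrow> a' \<noteq> blank M) \<and>
     Q_accept M \<inter> Q_reject M = {}"

text \<open>A configuration consists of the control state, the tape and the head position.\<close>

type_synonym ('q, 'a) config = "'q \<times> (int \<Rightarrow> 'a) \<times> int"

definition tm_init :: "('q, 'a) tm \<Rightarrow> 'a list \<Rightarrow> ('q, 'a) config" where
  "tm_init M x =
     (q0 M,
      (\<lambda>i. if 0 \<le> i \<and> i < int (length x) then x ! nat i else blank M),
      int (length x))"

fun tm_step :: "('q, 'a) tm \<Rightarrow> ('q, 'a) config \<Rightarrow> ('q, 'a) config" where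
  "tm_step M (q, tape, p) =
     (case delta M (q, tape p) of (q', a', m) \<Rightarrow> (q', tape(p := a'), p + offset m))"

definition tm_config :: "('q, 'a) tm \<Rightarrow> 'a list \<Rightarrow> nat \<Rightarrow> ('q, 'a) config" where
  "tm_config M x t = (tm_step M ^^ t) (tm_init M x)"

definition tm_state :: "('q, 'a) tm \<Rightarrow> 'a list \<Rightarrow> nat \<Rightarrow> 'q" where
  "tm_state M x t = fst (tm_config M x t)"

definition tm_head :: "('q, 'a) tm \<Rightarrow> 'a list \<Rightarrow> nat \<Rightarrow> int" where
  "tm_head M x t = snd (snd (tm_config M x t))"

text \<open>The machine always performs at least one step, even if the initial state happens to be
  accepting or rejecting.\<close>

definition tm_halts :: "('q, 'a) tm \<Rightarrow> 'a list \<Rightarrow> bool" where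
  "tm_halts M x \<longleftrightarrow> (\<exists>t\<ge>1. tm_state M x t \<in> Q_accept M \<union> Q_reject M)"

definition tm_time :: "('q, 'a) tm \<Rightarrow> 'a list \<Rightarrow> nat" where
  "tm_time M x = (LEAST t. t \<ge> 1 \<and> tm_state M x t \<in> Q_accept M \<union> Q_reject M)"

definition tm_accepts :: "('q, 'a) tm \<Rightarrow> 'a list \<Rightarrow> bool" where
  "tm_accepts M x \<longleftrightarrow> tm_halts M x \<and> tm_state M x (tm_time M x) \<in> Q_accept M"

definition tm_rejects :: "('q, 'a) tm \<Rightarrow> 'a list \<Rightarrow> bool" where
  "tm_rejects M x \<longleftrightarrow> tm_halts M x \<and> tm_state M x (tm_time M x) \<in> Q_reject M"

definition tm_space :: "('q, 'a) tm \<Rightarrow> 'a list \<Rightarrow> nat" where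
  "tm_space M x = card ({0..<int (length x)} \<union> tm_head M x ` {0..tm_time M x})"


section \<open>Transformers\<close>

text \<open>Vectors and matrices are functions on natural numbers, the dimensions being explicit
  parameters: a vector in $\mathbb R^n$ is represented by its entries at indices below $n$.  Every
  sum over an index is bounded by the respective dimension, so that entries outside of the
  dimensions never influence a result.  Sequence positions are counted from 1.\<close>

type_synonym rvec = "nat \<Rightarrow> real"
type_synonym rmat = "nat \<Rightarrow> nat \<Rightarrow> real"

definition mat_vec :: "nat \<Rightarrow> rmat \<Rightarrow> rvec \<Rightarrow> rvec" where
  "mat_vec n W v = (\<lambda>k. \<Sum>c<n. W k c * v c)"

definition transp_mat_vec :: "nat \<Rightarrow> rmat \<Rightarrow> rvec \<Rightarrow> rvec" where
  "transp_mat_vec m W v = (\<lambda>c. \<Sum>k<m. W k c * v k)"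

definition argmax_set :: "'i set \<Rightarrow> ('i \<Rightarrow> real) \<Rightarrow> 'i set" where
  "argmax_set I v = {j. is_arg_max v (\<lambda>j. j \<in> I) j}"

definition hardmax :: "'i set \<Rightarrow> ('i \<Rightarrow> real) \<Rightarrow> 'i \<Rightarrow> real" where
  "hardmax I v j = (if j \<in> argmax_set I v then 1 / real (card (argmax_set I v)) else 0)"

record attn_head =
  W_Q :: rmat
  W_K :: rmat
  W_V :: rmat
  W_O :: rmat

record layer =
  heads :: "nat \<Rightarrow> attn_head"
  W_0 :: rmat
  W_1 :: rmat
  W_2 :: rmat

text \<open>The heads of a layer have indices below \<open>n_heads\<close>, and layer number $\ell$ is
  \<open>layers \<theta> (\<ell> - 1)\<close>.\<close>

record 'v transformer =
  d_model :: nat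
  d_SA :: nat
  d_FF :: nat
  n_heads :: nat
  n_layers :: nat
  TE :: "'v \<Rightarrow> rvec"
  PE :: rvec
  layers :: "nat \<Rightarrow> layer"
  DEC :: "'v \<Rightarrow> rvec"

definition is_transformer :: "'v transformer \<Rightarrow> bool" where
  "is_transformer \<theta> \<longleftrightarrow>
     d_model \<theta> > 0 \<and> d_SA \<theta> > 0 \<and> d_FF \<theta> > 0 \<and> n_heads \<theta> > 0 \<and> n_layers \<theta> > 0"

definition attn_score ::
  "'v transformer \<Rightarrow> attn_head \<Rightarrow> (nat \<Rightarrow> rvec) \<Rightarrow> nat \<Rightarrow> nat \<Rightarrow> real" where
  "attn_score \<theta> A h i j =
     (\<Sum>k<d_SA \<theta>. mat_vec (d_model \<theta>) (W_Q A) (h i) k * mat_vec (d_model \<theta>) (W_K A) (h j) k)"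

definition attn ::
  "'v transformer \<Rightarrow> attn_head \<Rightarrow> (nat \<Rightarrow> rvec) \<Rightarrow> nat \<Rightarrow> rvec" where
  "attn \<theta> A h i =
     transp_mat_vec (d_SA \<theta>) (W_O A)
       (\<lambda>k. \<Sum>j\<in>{1..i}. hardmax {1..i} (attn_score \<theta> A h i) j *
                          mat_vec (d_model \<theta>) (W_V A) (h j) k)"

definition attn_layer ::
  "'v transformer \<Rightarrow> layer \<Rightarrow> (nat \<Rightarrow> rvec) \<Rightarrow> nat \<Rightarrow> rvec" where
  "attn_layer \<theta> ly h i = (\<lambda>c. h i c + (\<Sum>r<n_heads \<theta>. attn \<theta> (heads ly r) h i c))"

definition ffn_layer :: "'v transformer \<Rightarrow> layer \<Rightarrow> rvec \<Rightarrow> rvec" where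
  "ffn_layer \<theta> ly u =
     (\<lambda>c. u c + transp_mat_vec (d_FF \<theta>) (W_0 ly)
        (\<lambda>k. mat_vec (d_model \<theta>) (W_1 ly) u k * max (mat_vec (d_model \<theta>) (W_2 ly) u k) 0) c)"

primrec hidden :: "'v transformer \<Rightarrow> 'v list \<Rightarrow> nat \<Rightarrow> nat \<Rightarrow> rvec" where
  "hidden \<theta> x 0 = (\<lambda>i c. TE \<theta> (x ! (i - 1)) c + PE \<theta> c * real i)"
| "hidden \<theta> x (Suc l) =
     (\<lambda>i. ffn_layer \<theta> (layers \<theta> l) (attn_layer \<theta> (layers \<theta> l) (hidden \<theta> x l) i))"

definition logit :: "'v transformer \<Rightarrow> 'v list \<Rightarrow> 'v \<Rightarrow> real" where
  "logit \<theta> x a = (\<Sum>c<d_model \<theta>. DEC \<theta> a c * hidden \<theta> x (n_layers \<theta>) (length x) c)"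

text \<open>The next token is only meaningful if the sequence is nonempty and the maximum is attained
  exactly once; this is what \<open>next_token_defined\<close> expresses.\<close>

definition next_token_defined :: "'v transformer \<Rightarrow> 'v list \<Rightarrow> bool" where
  "next_token_defined \<theta> x \<longleftrightarrow> x \<noteq> [] \<and> (\<exists>!a. is_arg_max (logit \<theta> x) (\<lambda>_. True) a)"

definition next_token :: "'v transformer \<Rightarrow> 'v list \<Rightarrow> 'v" where
  "next_token \<theta> x = (ARG_MAX (logit \<theta> x) a. True)"


section \<open>PENCIL with the simplified reduction rule\<close>

datatype ('q, 'a) token = Sym 'q 'a move | SEP | RETURN

definition append_next :: "('v list \<Rightarrow> 'v) \<Rightarrow> 'v list \<Rightarrow> 'v list" where
  "append_next \<pi> y = y @ [\<pi> y]"

definition reducible :: "('q, 'a) token list \<Rightarrow> ('q, 'a) token list \<Rightarrow> bool" where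
  "reducible y T' \<longleftrightarrow>
     (\<exists>T. y = T @ [SEP] @ T' @ [RETURN]) \<and> SEP \<notin> set T' \<and> RETURN \<notin> set T'"

definition reduce :: "('q, 'a) token list \<Rightarrow> ('q, 'a) token list" where
  "reduce y = (if \<exists>T'. reducible y T' then THE T'. reducible y T' else y)"

lemma reducible_unique:
  assumes "reducible y T1" and "reducible y T2"
  shows "T1 = T2"
proof -
  have last: "rev (takeWhile (\<lambda>t. t \<noteq> SEP) (tl (rev y))) = T" if "reducible y T" for T
    using that by (auto simp: reducible_def takeWhile_append)
  show ?thesis
    using last[OF assms(1)] last[OF assms(2)] by simp
qed

lemma reduce_eq:
  assumes "SEP \<notin> set T'" and "RETURN \<notin> set T'"
  shows "reduce (T @ [SEP] @ T' @ [RETURN]) = T'"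
proof -
  have "reducible (T @ [SEP] @ T' @ [RETURN]) T'"
    using assms unfolding reducible_def by auto
  then show ?thesis
    unfolding reduce_def using reducible_unique by (metis (mono_tags, lifting) the_equality)
qed

text \<open>The sequence $y_0, y_1, \dots$ is continued beyond halting; only its part before halting is
  used below.\<close>

primrec pencil ::
  "(('q, 'a) token list \<Rightarrow> ('q, 'a) token) \<Rightarrow> ('q, 'a) token list \<Rightarrow> nat \<Rightarrow> ('q, 'a) token list"
  where
  "pencil \<pi> y 0 = y"
| "pencil \<pi> y (Suc j) = reduce (append_next \<pi> (pencil \<pi> y j))"

definition generated ::
  "(('q, 'a) token list \<Rightarrow> ('q, 'a) token) \<Rightarrow> ('q, 'a) token list \<Rightarrow> nat \<Rightarrow> ('q, 'a) token" where
  "generated \<pi> y j = \<pi> (pencil \<pi> y j)"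

definition tokens_of :: "'q set \<Rightarrow> ('q, 'a) token set" where
  "tokens_of Qs = {Sym q a m | q a m. q \<in> Qs}"

definition pencil_halts ::
  "('q, 'a) tm \<Rightarrow> (('q, 'a) token list \<Rightarrow> ('q, 'a) token) \<Rightarrow> ('q, 'a) token list \<Rightarrow> bool" where
  "pencil_halts M \<pi> y \<longleftrightarrow> (\<exists>j. generated \<pi> y j \<in> tokens_of (Q_accept M \<union> Q_reject M))"

definition pencil_last ::
  "('q, 'a) tm \<Rightarrow> (('q, 'a) token list \<Rightarrow> ('q, 'a) token) \<Rightarrow> ('q, 'a) token list \<Rightarrow> nat" where
  "pencil_last M \<pi> y = (LEAST j. generated \<pi> y j \<in> tokens_of (Q_accept M \<union> Q_reject M))"

definition pencil_tokens ::
  "('q, 'a) tm \<Rightarrow> (('q, 'a) token list \<Rightarrow> ('q, 'a) token) \<Rightarrow> ('q, 'a) token list \<Rightarrow> nat" where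
  "pencil_tokens M \<pi> y = Suc (pencil_last M \<pi> y)"

definition pencil_accepts ::
  "('q, 'a) tm \<Rightarrow> (('q, 'a) token list \<Rightarrow> ('q, 'a) token) \<Rightarrow> ('q, 'a) token list \<Rightarrow> bool" where
  "pencil_accepts M \<pi> y \<longleftrightarrow>
     pencil_halts M \<pi> y \<and> generated \<pi> y (pencil_last M \<pi> y) \<in> tokens_of (Q_accept M)"

definition pencil_rejects ::
  "('q, 'a) tm \<Rightarrow> (('q, 'a) token list \<Rightarrow> ('q, 'a) token) \<Rightarrow> ('q, 'a) token list \<Rightarrow> bool" where
  "pencil_rejects M \<pi> y \<longleftrightarrow>
     pencil_halts M \<pi> y \<and> generated \<pi> y (pencil_last M \<pi> y) \<in> tokens_of (Q_reject M)"

definition pencil_context ::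
  "('q, 'a) tm \<Rightarrow> (('q, 'a) token list \<Rightarrow> ('q, 'a) token) \<Rightarrow> ('q, 'a) token list \<Rightarrow> nat" where
  "pencil_context M \<pi> y =
     Max (insert (length y)
       ((\<lambda>j. length (append_next \<pi> (pencil \<pi> y j))) ` {..<pencil_tokens M \<pi> y}))"

definition encode_prompt :: "('q, 'a) tm \<Rightarrow> 'a list \<Rightarrow> ('q, 'a) token list" where
  "encode_prompt M x = map (\<lambda>a. Sym (q0 M) a MoveRight) x"

end

theory Submission
  imports Defs
begin

text \<open>The next token is computed by finitely many attention and gating operations, and one layer
  per operation realises them.  The head position is a prefix sum of moves, hence a uniform average
  times the sequence length.  The content of cell \<open>c\<close> is retrieved by attending to the latest token
  that wrote at \<open>c\<close>: the integer quantity \<open>(write_pos - c)\<^sup>2\<close>, scaled by more than the sequence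
  length, dominates the tie-breaking term \<open>j\<close>, so that the maximum is unique.

  Machine steps are appended to the context until its length reaches four times the number \<open>R\<close> of
  visited cells; then the configuration is rewritten as a trace of length at most \<open>2 * R\<close>.  Such a
  reduction costs at most \<open>2 * R + 2\<close> tokens and is preceded by at least \<open>2 * R\<close> machine
  steps, which pay for it.\<close>

section \<open>Functions computed by transformers\<close>

text \<open>Causal masking makes every entry of the residual stream at position \<open>i\<close> a
  function of the prefix of length \<open>i\<close>, so the objects compiled are real functions on
  nonempty lists, and keys and values at position \<open>j\<close> are such functions applied to
  \<open>take j y\<close>. The obstacle is that depth is fixed and a head only averages over
  maximisers, yet every quantity behind a token must come out exactly for all lengths. Integrality
  provides this: distinct integers differ by at least 1, so a ReLU decides comparisons and a scaled
  square separates cells. A reduction erases the prompt along with the old trace, and positions are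
  counted from 0 again. Hence a trace describes a configuration only up to a translation, and a
  summary has to visit exactly the cells visited before; otherwise the space read off the next trace
  would drift. The factor 3 in the time bound: each machine step pays for its own token and saves
  two more. The \<open>2 * R\<close> steps before a reduction save \<open>4 * R\<close>, which
  covers \<open>2 * R + 2\<close> because \<open>R\<close> is at least 1.\<close>

definition attend ::
  "(nat \<Rightarrow> 'v list \<Rightarrow> real) \<Rightarrow> (nat \<Rightarrow> 'v list \<Rightarrow> real) \<Rightarrow> ('v list \<Rightarrow> real) \<Rightarrow> 'v list \<Rightarrow> real" where
  "attend q \<kappa> v y =
     (\<Sum>j\<in>{1..length y}. hardmax {1..length y} (\<lambda>j. \<Sum>r<3. q r y * \<kappa> r (take j y)) j * v (take j y))"

text \<open>In \<open>attend\<close> queries see the whole list, keys and values its prefixes: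
  causal attention as seen from the last position. The rule \<open>cong\<close> discards values at
  the empty list, which is never an input.\<close>

inductive feature :: "('v list \<Rightarrow> real) \<Rightarrow> bool" where
  token: "feature (\<lambda>y. f (last y))"
| length: "feature (\<lambda>y. real (length y))"
| add: "feature f \<Longrightarrow> feature g \<Longrightarrow> feature (\<lambda>y. f y + g y)"
| cmult: "feature f \<Longrightarrow> feature (\<lambda>y. c * f y)"
| gate: "feature f \<Longrightarrow> feature g \<Longrightarrow> feature (\<lambda>y. f y * max (g y) 0)"
| attend: "(\<And>r. feature (q r)) \<Longrightarrow> (\<And>r. feature (\<kappa> r)) \<Longrightarrow> feature v \<Longrightarrow> feature (attend q \<kappa> v)"
| cong: "feature f \<Longrightarrow> (\<And>y. y \<noteq> [] \<Longrightarrow> g y = f y) \<Longrightarrow> feature g"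

definition lin :: "(nat \<Rightarrow> 'v list \<Rightarrow> real) \<Rightarrow> nat \<Rightarrow> rvec \<Rightarrow> 'v list \<Rightarrow> real" where
  "lin F k w y = (\<Sum>c<k. w c * F c y)"

definition spanned :: "(nat \<Rightarrow> 'v list \<Rightarrow> real) \<Rightarrow> nat \<Rightarrow> ('v list \<Rightarrow> real) \<Rightarrow> bool" where
  "spanned F k f \<longleftrightarrow> (\<exists>w. \<forall>y. y \<noteq> [] \<longrightarrow> f y = lin F k w y)"

text \<open>Linear combinations are free, since the weight matrices form them; only a gate or an
  attention consumes a layer.\<close>

definition instruction :: "(nat \<Rightarrow> 'v list \<Rightarrow> real) \<Rightarrow> nat \<Rightarrow> bool" where
  "instruction F k \<longleftrightarrow>
     (\<exists>u v. \<forall>y. y \<noteq> [] \<longrightarrow> F k y = lin F k u y * max (lin F k v y) 0) \<or>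
     (\<exists>q \<kappa> v. \<forall>y. y \<noteq> [] \<longrightarrow>
        F k y = attend (\<lambda>r. lin F k (q r)) (\<lambda>r. lin F k (\<kappa> r)) (lin F k v) y)"

text \<open>A straight-line program: the embedding supplies the first \<open>D\<close> coordinates,
  and each later one depends only on its predecessors.\<close>

definition program ::
  "nat \<Rightarrow> (nat \<Rightarrow> 'v list \<Rightarrow> real) \<Rightarrow> (nat \<Rightarrow> 'v list \<Rightarrow> real) \<Rightarrow> nat \<Rightarrow> bool" where
  "program D B F n \<longleftrightarrow> D \<le> n \<and> (\<forall>c<D. F c = B c) \<and> (\<forall>k. D \<le> k \<and> k < n \<longrightarrow> instruction F k)"

section \<open>Straight-line programs and their extension\<close>

lemma hardmax_cong:
  assumes "\<And>j. j \<in> I \<Longrightarrow> u j = u' j"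
  shows "hardmax I u = hardmax I u'"
proof -
  have eq: "argmax_set I u = argmax_set I u'"
    unfolding argmax_set_def is_arg_max_def using assms by auto
  show ?thesis
    unfolding hardmax_def eq ..
qed

lemma attend_cong:
  assumes "y \<noteq> []"
    and "\<And>r y. y \<noteq> [] \<Longrightarrow> r < 3 \<Longrightarrow> q r y = q' r y"
    and "\<And>r y. y \<noteq> [] \<Longrightarrow> r < 3 \<Longrightarrow> \<kappa> r y = \<kappa>' r y"
    and "\<And>y. y \<noteq> [] \<Longrightarrow> v y = v' y"
  shows "attend q \<kappa> v y = attend q' \<kappa>' v' y"
proof -
  have ne: "take j y \<noteq> []" if "j \<in> {1..length y}" for j
    using that assms(1) by auto
  have hm: "hardmax {1..length y} (\<lambda>j. \<Sum>r<3. q r y * \<kappa> r (take j y))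
      = hardmax {1..length y} (\<lambda>j. \<Sum>r<3. q' r y * \<kappa>' r (take j y))"
    by (intro hardmax_cong sum.cong refl) (simp add: ne assms(1-3))
  show ?thesis
    unfolding attend_def hm by (intro sum.cong refl arg_cong2[where f = "(*)"] assms(4) ne)
qed

text \<open>Padding the weights with zeros keeps a combination of early coordinates available in
  every longer program.\<close>

lemma lin_mono:
  assumes "k \<le> k'" "\<And>c. c < k \<Longrightarrow> F' c = F c"
  shows "lin F' k' (\<lambda>c. if c < k then w c else 0) y = lin F k w y"
proof -
  have "lin F' k' (\<lambda>c. if c < k then w c else 0) y = (\<Sum>c<k'. if c < k then w c * F' c y else 0)"
    unfolding lin_def by (intro sum.cong) auto
  also have "\<dots> = (\<Sum>c\<in>{..<k'} \<inter> {c. c < k}. w c * F' c y)"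
    by (simp add: sum.inter_restrict)
  also have "{..<k'} \<inter> {c. c < k} = {..<k}"
    using assms(1) by auto
  finally show ?thesis
    unfolding lin_def using assms(2) by simp
qed

lemma spanned_mono:
  assumes "spanned F k f" "k \<le> k'" "\<And>c. c < k \<Longrightarrow> F' c = F c"
  shows "spanned F' k' f"
proof -
  obtain w where "\<forall>y. y \<noteq> [] \<longrightarrow> f y = lin F k w y"
    using assms(1) unfolding spanned_def by blast
  then have "\<forall>y. y \<noteq> [] \<longrightarrow> f y = lin F' k' (\<lambda>c. if c < k then w c else 0) y"
    by (simp add: lin_mono[OF assms(2,3)])
  then show ?thesis
    unfolding spanned_def by blast
qed

lemma lin_cong:
  assumes "\<And>c. c < k \<Longrightarrow> F' c = F c"
  shows "lin F' k = lin F k"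
  unfolding lin_def using assms by (intro ext sum.cong) auto

lemma instruction_cong:
  assumes "\<And>c. c \<le> k \<Longrightarrow> F' c = F c"
  shows "instruction F' k = instruction F k"
proof -
  have "lin F' k = lin F k" "F' k = F k"
    using assms lin_cong[of k F' F] by auto
  then show ?thesis
    unfolding instruction_def by simp
qed

lemma program_snoc:
  assumes "program D B F n"
    and "instruction (F(n := f)) n"
  shows "program D B (F(n := f)) (Suc n)"
  unfolding program_def
proof (intro conjI allI impI)
  show "D \<le> Suc n"
    using assms(1) by (simp add: program_def)
  show "(F(n := f)) c = B c" if "c < D" for c
    using assms(1) that by (simp add: program_def)
  show "instruction (F(n := f)) k" if "D \<le> k \<and> k < Suc n" for k
  proof (cases "k = n")
    case False
    then have "instruction (F(n := f)) k = instruction F k"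
      using that by (intro instruction_cong) simp
    then show ?thesis
      using assms(1) that False by (simp add: program_def)
  qed (use assms(2) in simp)
qed

lemma spanned_coordinate:
  assumes "k < n"
  shows "spanned F n (F k)"
proof -
  have "F k y = lin F n (\<lambda>c. if c = k then 1 else 0) y" for y
  proof -
    have "lin F n (\<lambda>c. if c = k then 1 else 0) y = (\<Sum>c<n. if c = k then F c y else 0)"
      unfolding lin_def by (intro sum.cong) auto
    then show ?thesis using assms by simp
  qed
  then show ?thesis
    unfolding spanned_def by blast
qed

text \<open>Quantifying over all programs already built lets compilations be chained: the next one
  starts from the result of the previous one and leaves its coordinates intact.\<close>

definition compilable :: "nat \<Rightarrow> (nat \<Rightarrow> 'v list \<Rightarrow> real) \<Rightarrow> ('v list \<Rightarrow> real) set \<Rightarrow> bool" where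
  "compilable D B fs \<longleftrightarrow> (\<forall>F n. program D B F n \<longrightarrow>
     (\<exists>F' n'. program D B F' n' \<and> n \<le> n' \<and> (\<forall>c<n. F' c = F c) \<and> (\<forall>f\<in>fs. spanned F' n' f)))"

lemma compilable_Un:
  assumes "compilable D B fs" "compilable D B gs"
  shows "compilable D B (fs \<union> gs)"
  unfolding compilable_def
proof (intro allI impI)
  fix F n assume F: "program D B F n"
  obtain F1 n1 where 1: "program D B F1 n1" "n \<le> n1" "\<forall>c<n. F1 c = F c"
    "\<forall>f\<in>fs. spanned F1 n1 f"
    using assms(1) F unfolding compilable_def by blast
  obtain F2 n2 where 2: "program D B F2 n2" "n1 \<le> n2" "\<forall>c<n1. F2 c = F1 c"
    "\<forall>f\<in>gs. spanned F2 n2 f"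
    using assms(2) 1(1) unfolding compilable_def by blast
  have same: "\<forall>c<n. F2 c = F c"
  proof (intro allI impI)
    fix c assume "c < n"
    then show "F2 c = F c" using 1(2,3) 2(3) by simp
  qed
  have span: "spanned F2 n2 f" if "f \<in> fs" for f
    using spanned_mono[of F1 n1 f n2 F2] 1(4) 2(2,3) that by blast
  then show "\<exists>F' n'. program D B F' n' \<and> n \<le> n' \<and> (\<forall>c<n. F' c = F c) \<and>
      (\<forall>f\<in>fs \<union> gs. spanned F' n' f)"
  proof (intro exI conjI)
    show "program D B F2 n2" "\<forall>c<n. F2 c = F c" by fact+
    show "n \<le> n2" using 1(2) 2(2) by simp
    show "\<forall>f\<in>fs \<union> gs. spanned F2 n2 f" using span 2(4) by blast
  qed
qed

lemma compilable_UN: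
  assumes "finite I" "\<And>i. i \<in> I \<Longrightarrow> compilable D B (fs i)"
  shows "compilable D B (\<Union>i\<in>I. fs i)"
  using assms
proof (induction I)
  case empty
  show ?case by (auto simp: compilable_def)
next
  case (insert i I)
  then have "compilable D B (fs i \<union> (\<Union>i\<in>I. fs i))"
    by (intro compilable_Un insert.IH) auto
  then show ?case by simp
qed

lemma compilable_spanned:
  assumes "compilable D B fs"
    and "\<And>F n. \<lbrakk>program D B F n; \<And>f. f \<in> fs \<Longrightarrow> spanned F n f\<rbrakk> \<Longrightarrow> spanned F n g"
  shows "compilable D B {g}"
  unfolding compilable_def
proof (intro allI impI)
  fix F n assume "program D B F n"
  then obtain F' n' where "program D B F' n'" "n \<le> n'" "\<forall>c<n. F' c = F c" "\<forall>f\<in>fs. spanned F' n' f"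
    using assms(1) unfolding compilable_def by blast
  then show "\<exists>F' n'. program D B F' n' \<and> n \<le> n' \<and> (\<forall>c<n. F' c = F c) \<and>
      (\<forall>f\<in>{g}. spanned F' n' f)"
    using assms(2)[of F' n'] by (intro exI[of _ F'] exI[of _ n']) auto
qed

lemma compilable_instruction:
  assumes "compilable D B fs"
    and "\<And>F n. \<lbrakk>program D B F n; \<And>f. f \<in> fs \<Longrightarrow> spanned F n f\<rbrakk> \<Longrightarrow> instruction (F(n := g)) n"
  shows "compilable D B {g}"
  unfolding compilable_def
proof (intro allI impI)
  fix F n assume F: "program D B F n"
  obtain F1 n1 where 1: "program D B F1 n1" "n \<le> n1" "\<forall>c<n. F1 c = F c"
    "\<forall>f\<in>fs. spanned F1 n1 f"
    using assms(1) F unfolding compilable_def by blast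
  let ?F = "F1(n1 := g)"
  have "program D B ?F (Suc n1)"
    using 1 assms(2) by (intro program_snoc) auto
  moreover have "spanned ?F (Suc n1) g"
    using spanned_coordinate[of n1 "Suc n1" ?F] by simp
  ultimately show "\<exists>F' n'. program D B F' n' \<and> n \<le> n' \<and> (\<forall>c<n. F' c = F c) \<and>
      (\<forall>f\<in>{g}. spanned F' n' f)"
    using 1(2,3) by (intro exI[of _ ?F] exI[of _ "Suc n1"]) auto
qed

lemma spanned_add:
  assumes "spanned F n f" "spanned F n g"
  shows "spanned F n (\<lambda>y. f y + g y)"
proof -
  obtain w w' where "\<And>y. y \<noteq> [] \<Longrightarrow> f y = lin F n w y" "\<And>y. y \<noteq> [] \<Longrightarrow> g y = lin F n w' y"
    using assms unfolding spanned_def by metis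
  then show ?thesis
    unfolding spanned_def lin_def
    by (intro exI[of _ "\<lambda>c. w c + w' c"]) (simp add: sum.distrib algebra_simps)
qed

lemma spanned_cmult:
  assumes "spanned F n f"
  shows "spanned F n (\<lambda>y. a * f y)"
proof -
  obtain w where "\<And>y. y \<noteq> [] \<Longrightarrow> f y = lin F n w y"
    using assms unfolding spanned_def by metis
  then show ?thesis
    unfolding spanned_def lin_def
    by (intro exI[of _ "\<lambda>c. a * w c"]) (simp add: sum_distrib_left algebra_simps)
qed

lemma spanned_sum:
  assumes "finite I" "\<And>i. i \<in> I \<Longrightarrow> spanned F n (f i)"
  shows "spanned F n (\<lambda>y. \<Sum>i\<in>I. f i y)"
  using assms
proof (induction I)
  case empty
  show ?case by (auto simp: spanned_def lin_def intro!: exI[of _ "\<lambda>_. 0"])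
next
  case (insert i I)
  then show ?case by (simp add: spanned_add)
qed

text \<open>One-hot token coordinates followed by the position, which is the length of the prefix
  because positions start at 1; token and positional embedding deliver exactly these.\<close>

definition input_coordinates :: "(nat \<Rightarrow> 'v) \<Rightarrow> nat \<Rightarrow> nat \<Rightarrow> 'v list \<Rightarrow> real" where
  "input_coordinates e V c y = (if c < V then of_bool (last y = e c) else real (length y))"

text \<open>Induction on the construction: a function of the last token is linear in its one-hot
  coordinates, sums and multiples stay in the span, and each gate or attention appends one
  coordinate.\<close>

lemma feature_compilable:
  assumes "bij_betw e {..<V} (UNIV :: 'v set)"
    and "feature (f :: 'v list \<Rightarrow> real)"
  shows "compilable (Suc V) (input_coordinates e V) {f}"
  using assms(2)
proof induction
  case (token f)
  show ?case
  proof (rule compilable_spanned[of _ _ "{}"])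
    show "compilable (Suc V) (input_coordinates e V) {}"
      by (auto simp: compilable_def)
    fix F :: "nat \<Rightarrow> 'v list \<Rightarrow> real" and n assume F: "program (Suc V) (input_coordinates e V) F n"
    have "spanned F n (\<lambda>y. f (e c) * F c y)" if "c \<in> {..<V}" for c
      using that F by (intro spanned_cmult spanned_coordinate) (auto simp: program_def)
    then have "spanned F n (\<lambda>y. \<Sum>c\<in>{..<V}. f (e c) * F c y)"
      by (rule spanned_sum[rotated]) auto
    moreover have "(\<Sum>c\<in>{..<V}. f (e c) * F c y) = f (last y)" for y
    proof -
      have "(\<Sum>c\<in>{..<V}. f (e c) * F c y) = (\<Sum>c\<in>{..<V}. f (e c) * of_bool (last y = e c))"
        using F by (intro sum.cong) (auto simp: program_def input_coordinates_def)
      also have "\<dots> = (\<Sum>a\<in>UNIV. f a * of_bool (last y = a))"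
        by (rule sum.reindex_bij_betw[OF assms(1)])
      also have "\<dots> = (\<Sum>a\<in>UNIV. if a = last y then f a else 0)"
        by (intro sum.cong) auto
      also have "\<dots> = f (last y)"
        using bij_betw_finite[OF assms(1)] by simp
      finally show ?thesis .
    qed
    ultimately show "spanned F n (\<lambda>y. f (last y))" by simp
  qed
next
  case length
  show ?case
  proof (rule compilable_spanned[of _ _ "{}"])
    show "compilable (Suc V) (input_coordinates e V) {}"
      by (auto simp: compilable_def)
    fix F :: "nat \<Rightarrow> 'v list \<Rightarrow> real" and n assume "program (Suc V) (input_coordinates e V) F n"
    then have "F V = (\<lambda>y. real (length y))" "V < n"
      by (auto simp: program_def input_coordinates_def)
    then show "spanned F n (\<lambda>y. real (length y))"
      using spanned_coordinate[of V n F] by simp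
  qed
next
  case (add f g)
  then show ?case
    by (intro compilable_spanned[OF compilable_Un[OF add.IH]] spanned_add) auto
next
  case (cmult f c)
  then show ?case
    by (intro compilable_spanned[OF cmult.IH] spanned_cmult) auto
next
  case (gate f g)
  show ?case
  proof (rule compilable_instruction[OF compilable_Un[OF gate.IH]])
    fix F :: "nat \<Rightarrow> 'v list \<Rightarrow> real" and n
    assume "\<And>h. h \<in> {f} \<union> {g} \<Longrightarrow> spanned F n h"
    then obtain u v where "\<And>y. y \<noteq> [] \<Longrightarrow> f y = lin F n u y" "\<And>y. y \<noteq> [] \<Longrightarrow> g y = lin F n v y"
      unfolding spanned_def by (metis UnI1 UnI2 singletonI)
    then show "instruction (F(n := \<lambda>y. f y * max (g y) 0)) n"
      unfolding instruction_def
      \<comment> \<open>Setting coordinate \<open>n\<close> does not affect combinations of the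
        coordinates below \<open>n\<close>.\<close>
      by (subst (1 2 3 4 5) lin_cong[of n "F(n := \<lambda>y. f y * max (g y) 0)" F]) auto
  qed
next
  case (attend q \<kappa> v)
  \<comment> \<open>Only the three indices summed over in \<open>attend\<close> are compiled, which
    keeps the union finite.\<close>
  let ?fs = "(\<Union>r\<in>{..<3}. {q r}) \<union> ((\<Union>r\<in>{..<3}. {\<kappa> r}) \<union> {v})"
  have "compilable (Suc V) (input_coordinates e V) ?fs"
    using attend.IH by (intro compilable_Un compilable_UN) auto
  then show ?case
  proof (rule compilable_instruction)
    fix F :: "nat \<Rightarrow> 'v list \<Rightarrow> real" and n
    assume *: "\<And>h. h \<in> ?fs \<Longrightarrow> spanned F n h"
    have "\<forall>r. \<exists>w. r < 3 \<longrightarrow> (\<forall>y. y \<noteq> [] \<longrightarrow> q r y = lin F n w y)"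
      using * unfolding spanned_def by blast
    then obtain Q where Q: "\<And>r y. r < 3 \<Longrightarrow> y \<noteq> [] \<Longrightarrow> q r y = lin F n (Q r) y"
      by metis
    have "\<forall>r. \<exists>w. r < 3 \<longrightarrow> (\<forall>y. y \<noteq> [] \<longrightarrow> \<kappa> r y = lin F n w y)"
      using * unfolding spanned_def by blast
    then obtain K where K: "\<And>r y. r < 3 \<Longrightarrow> y \<noteq> [] \<Longrightarrow> \<kappa> r y = lin F n (K r) y"
      by metis
    obtain w where w: "\<And>y. y \<noteq> [] \<Longrightarrow> v y = lin F n w y"
      using *[of v] unfolding spanned_def by blast
    have "attend q \<kappa> v y = attend (\<lambda>r. lin F n (Q r)) (\<lambda>r. lin F n (K r)) (lin F n w) y" if "y \<noteq> []" for y
      using that Q K w by (intro attend_cong) auto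
    moreover have "lin (F(n := attend q \<kappa> v)) n = lin F n"
      by (rule lin_cong) auto
    ultimately show "instruction (F(n := attend q \<kappa> v)) n"
      unfolding instruction_def
      by (intro disjI2 exI[of _ Q] exI[of _ K] exI[of _ w]) simp
  qed
next
  case (cong f g)
  show ?case
  proof (rule compilable_spanned[OF cong.IH])
    fix F :: "nat \<Rightarrow> 'v list \<Rightarrow> real" and n
    assume "\<And>h. h \<in> {f} \<Longrightarrow> spanned F n h"
    then obtain w where "\<And>y. y \<noteq> [] \<Longrightarrow> f y = lin F n w y"
      unfolding spanned_def by blast
    then show "spanned F n g"
      unfolding spanned_def using cong.hyps(2) by (intro exI[of _ w]) simp
  qed
qed

text \<open>Coordinates not yet computed hold 0. The layer adds the value of the instruction to
  coordinate \<open>k\<close>, and the residual connections preserve the rest; one head with three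
  dimensions and one gated unit suffice for this.\<close>

lemma instruction_layer:
  fixes \<theta> :: "'v transformer" and F :: "nat \<Rightarrow> 'v list \<Rightarrow> real"
  assumes dims: "d_model \<theta> = d" "d_SA \<theta> = 3" "d_FF \<theta> = 1" "n_heads \<theta> = 1"
    and "instruction F k" "k < d"
  shows "\<exists>ly. \<forall>h x i. 1 \<le> i \<and> i \<le> length x \<and>
      (\<forall>j\<in>{1..i}. \<forall>c<d. h j c = (if c < k then F c (take j x) else 0)) \<longrightarrow>
      (\<forall>c<d. ffn_layer \<theta> ly (attn_layer \<theta> ly h i) c = (if c < Suc k then F c (take i x) else 0))"
proof -
  let ?w = "\<lambda>w c. if c < k then w c else (0::real)"
  have mv: "(\<Sum>c<d. ?w w c * g c) = lin F k w z"
    if "\<And>c. c < d \<Longrightarrow> g c = (if c < k then F c z else 0)" for w g z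
  proof -
    have "(\<Sum>c<d. ?w w c * g c) = lin F d (?w w) z"
      unfolding lin_def using that by (intro sum.cong) auto
    then show ?thesis
      using lin_mono[of k d F F w z] assms(6) by simp
  qed
  from assms(5) consider
      (gate) u v where "\<And>y. y \<noteq> [] \<Longrightarrow> F k y = lin F k u y * max (lin F k v y) 0"
    | (attend) q \<kappa> v where "\<And>y. y \<noteq> [] \<Longrightarrow>
        F k y = attend (\<lambda>r. lin F k (q r)) (\<lambda>r. lin F k (\<kappa> r)) (lin F k v) y"
    unfolding instruction_def by blast
  then show ?thesis
  proof cases
    case gate
    \<comment> \<open>The head is switched off by zero weights, and the single gated unit writes
      into coordinate \<open>k\<close>.\<close>
    define A where "A = \<lparr>W_Q = \<lambda>_ _. 0, W_K = \<lambda>_ _. 0, W_V = \<lambda>_ _. 0, W_O = \<lambda>_ _. 0\<rparr>"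
    define ly where "ly = \<lparr>heads = \<lambda>_. A, W_0 = \<lambda>_ c. of_bool (c = k), W_1 = \<lambda>_. ?w u, W_2 = \<lambda>_. ?w v\<rparr>"
    show ?thesis
    proof (intro exI[of _ ly] allI impI, elim conjE)
      fix h :: "nat \<Rightarrow> rvec" and x :: "'v list" and i c
      assume i: "1 \<le> i" "i \<le> length x" and c: "c < d"
        and h: "\<forall>j\<in>{1..i}. \<forall>c<d. h j c = (if c < k then F c (take j x) else 0)"
      have a: "attn_layer \<theta> ly h i = h i"
        by (auto simp: attn_layer_def attn_def transp_mat_vec_def ly_def A_def)
      have hi: "\<And>c. c < d \<Longrightarrow> h i c = (if c < k then F c (take i x) else 0)"
        using h i by auto
      have "take i x \<noteq> []" using i by auto
      then have Fk: "F k (take i x) = lin F k u (take i x) * max (lin F k v (take i x)) 0"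
        by (rule gate)
      have "ffn_layer \<theta> ly (h i) c = h i c + of_bool (c = k) * F k (take i x)"
        unfolding Fk ffn_layer_def transp_mat_vec_def mat_vec_def
        using mv[where g = "h i", OF hi] by (simp add: dims ly_def)
      then show "ffn_layer \<theta> ly (attn_layer \<theta> ly h i) c = (if c < Suc k then F c (take i x) else 0)"
        using hi[OF c] by (auto simp: a less_Suc_eq)
    qed
  next
    case attend
    \<comment> \<open>All three rows of \<open>W_V\<close> carry the same value, and
      \<open>W_O\<close> reads only row 0, so the value is added once.\<close>
    define A where "A = \<lparr>W_Q = \<lambda>r. ?w (q r), W_K = \<lambda>r. ?w (\<kappa> r), W_V = \<lambda>_. ?w v,
       W_O = \<lambda>r c. of_bool (r = 0 \<and> c = k)\<rparr>"
    define ly where "ly = \<lparr>heads = \<lambda>_. A, W_0 = \<lambda>_ _. 0, W_1 = \<lambda>_ _. 0, W_2 = \<lambda>_ _. 0\<rparr>"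
    show ?thesis
    proof (intro exI[of _ ly] allI impI, elim conjE)
      fix h :: "nat \<Rightarrow> rvec" and x :: "'v list" and i c
      assume i: "1 \<le> i" "i \<le> length x" and c: "c < d"
        and h: "\<forall>j\<in>{1..i}. \<forall>c<d. h j c = (if c < k then F c (take j x) else 0)"
      have hj: "\<And>c. c < d \<Longrightarrow> h j c = (if c < k then F c (take j x) else 0)" if "j \<in> {1..i}" for j
        using h that by auto
      have ff: "ffn_layer \<theta> ly g = g" for g
        by (auto simp: ffn_layer_def transp_mat_vec_def ly_def)
      have "take i x \<noteq> []" using i by auto
      then have Fk: "F k (take i x) =
          attend (\<lambda>r. lin F k (q r)) (\<lambda>r. lin F k (\<kappa> r)) (lin F k v) (take i x)"
        by (rule attend)
      have mvj: "(\<Sum>c<d. ?w w c * h j c) = lin F k w (take j (take i x))" if "j \<in> {1..i}" for w j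
        using mv[where g = "h j", OF hj[OF that]] that by (simp add: min_def)
      let ?s = "\<lambda>j. \<Sum>r<3. lin F k (q r) (take i x) * lin F k (\<kappa> r) (take j (take i x))"
      have s: "attn_score \<theta> A h i j = ?s j" if "j \<in> {1..i}" for j
        unfolding attn_score_def mat_vec_def A_def dims attn_head.simps mvj[OF that]
        using mvj[of i] i by simp
      have hm: "hardmax {1..i} (attn_score \<theta> A h i) = hardmax {1..i} ?s"
        using s by (rule hardmax_cong)
      have len: "length (take i x) = i"
        using i by simp
      have "(\<Sum>j\<in>{1..i}. hardmax {1..i} (attn_score \<theta> A h i) j * mat_vec (d_model \<theta>) (W_V A) (h j) r)
          = F k (take i x)" for r
        unfolding Fk attend_def hm mat_vec_def dims len
        by (intro sum.cong refl arg_cong2[where f = "(*)"]) (simp add: A_def mvj)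
      then have "attn \<theta> A h i c = of_bool (c = k) * F k (take i x)"
        unfolding attn_def transp_mat_vec_def dims by (simp add: A_def eval_nat_numeral)
      then have "attn_layer \<theta> ly h i c = h i c + of_bool (c = k) * F k (take i x)"
        unfolding attn_layer_def dims by (simp add: ly_def)
      then show "ffn_layer \<theta> ly (attn_layer \<theta> ly h i) c = (if c < Suc k then F c (take i x) else 0)"
        using hj[of i c] c i by (auto simp: ff less_Suc_eq)
    qed
  qed
qed

text \<open>The embedding fills the first \<open>Suc V\<close> coordinates, layer index
  \<open>l\<close> fills coordinate \<open>Suc V + l\<close>, and the decoder rows are the weights
  that express each \<open>G a\<close> through the final coordinates.\<close>

lemma transformer_of_features:
  fixes G :: "'v \<Rightarrow> 'v list \<Rightarrow> real"
  assumes "finite (UNIV :: 'v set)" and "\<And>a. feature (G a)"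
  shows "\<exists>\<theta>. is_transformer \<theta> \<and> (\<forall>y a. y \<noteq> [] \<longrightarrow> logit \<theta> y a = G a y)"
proof -
  obtain e where e: "bij_betw e {..<card (UNIV :: 'v set)} (UNIV :: 'v set)"
    using ex_bij_betw_nat_finite[OF assms(1)] by (metis atLeast0LessThan)
  define V where "V = card (UNIV :: 'v set)"
  let ?B = "input_coordinates e V"
  note e = e[folded V_def]
  have "compilable (Suc V) ?B (\<Union>a\<in>UNIV. {G a})"
    using assms feature_compilable[OF e] by (intro compilable_UN) auto
  \<comment> \<open>Starting with one extra coordinate that is constantly 0 guarantees at least one
    layer, as \<open>is_transformer\<close> demands.\<close>
  moreover have "program (Suc V) ?B (\<lambda>c. if c < Suc V then ?B c else (\<lambda>_. 0)) (Suc (Suc V))"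
    unfolding program_def instruction_def by (auto simp: lin_def intro!: exI[of _ "\<lambda>_. 0"])
  ultimately obtain F n where F: "program (Suc V) ?B F n" "Suc (Suc V) \<le> n"
      and span: "\<forall>f\<in>(\<Union>a\<in>UNIV. {G a}). spanned F n f"
    unfolding compilable_def by blast
  have "\<forall>a. \<exists>w. \<forall>y. y \<noteq> [] \<longrightarrow> G a y = lin F n w y"
    using span unfolding spanned_def by blast
  then obtain w where w: "\<And>a y. y \<noteq> [] \<Longrightarrow> G a y = lin F n (w a) y"
    unfolding spanned_def by metis
  \<comment> \<open>The layers are left open: each of them is obtained from the dimensions alone and
    filled in afterwards.\<close>
  define \<theta>\<^sub>0 where "\<theta>\<^sub>0 = \<lparr>d_model = n, d_SA = 3, d_FF = 1, n_heads = 1, n_layers = n - Suc V,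
    TE = (\<lambda>t c. if c < V then of_bool (t = e c) else 0), PE = (\<lambda>c. of_bool (c = V)),
    layers = undefined, DEC = w\<rparr>"
  let ?Q = "\<lambda>l ly. \<forall>h x i. 1 \<le> i \<and> i \<le> length x \<and>
      (\<forall>j\<in>{1..i}. \<forall>c<n. h j c = (if c < Suc V + l then F c (take j x) else 0)) \<longrightarrow>
      (\<forall>c<n. ffn_layer \<theta>\<^sub>0 ly (attn_layer \<theta>\<^sub>0 ly h i) c
         = (if c < Suc (Suc V + l) then F c (take i x) else 0))"
  have "\<exists>ly. ?Q l ly" if "l < n - Suc V" for l
    by (rule instruction_layer) (use F that in \<open>auto simp: \<theta>\<^sub>0_def program_def\<close>)
  then have "\<forall>l. \<exists>ly. l < n - Suc V \<longrightarrow> ?Q l ly"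
    by blast
  from choice[OF this] obtain ly where ly: "\<And>l. l < n - Suc V \<Longrightarrow> ?Q l (ly l)"
    by blast
  define \<theta> where "\<theta> = \<theta>\<^sub>0\<lparr>layers := ly\<rparr>"
  have ffn: "ffn_layer \<theta> = ffn_layer \<theta>\<^sub>0"
    by (simp add: \<theta>_def fun_eq_iff ffn_layer_def)
  have score: "attn_score \<theta> A h i = attn_score \<theta>\<^sub>0 A h i" for A h i
    by (simp add: \<theta>_def fun_eq_iff attn_score_def)
  have attn: "attn_layer \<theta> = attn_layer \<theta>\<^sub>0"
    unfolding fun_eq_iff attn_layer_def attn_def score by (simp add: \<theta>_def)
  have hidden: "\<forall>i. 1 \<le> i \<and> i \<le> length x \<longrightarrow>
      (\<forall>c<n. hidden \<theta> x l i c = (if c < Suc V + l then F c (take i x) else 0))"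
    if "l \<le> n - Suc V" for l x
    using that
  proof (induction l)
    case 0
    have "last (take i x) = x ! (i - 1)" if "1 \<le> i" "i \<le> length x" for i
      using that by (subst last_conv_nth) (auto simp: min_def)
    then show ?case
      using F by (auto simp: \<theta>_def \<theta>\<^sub>0_def program_def input_coordinates_def)
  next
    case (Suc l)
    then show ?case
      unfolding hidden.simps ffn attn using ly[of l] by (simp add: \<theta>_def)
  qed
  have "logit \<theta> y a = G a y" if y: "y \<noteq> []" for y a
  proof -
    have "hidden \<theta> y (n_layers \<theta>) (length y) c = F c y" if "c < n" for c
      using hidden[of "n - Suc V" y] that y F(2) by (simp add: \<theta>_def \<theta>\<^sub>0_def Suc_le_eq)
    then show ?thesis
      unfolding logit_def w[OF y] lin_def by (simp add: \<theta>_def \<theta>\<^sub>0_def)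
  qed
  moreover have "is_transformer \<theta>"
    using F(2) by (simp add: is_transformer_def \<theta>_def \<theta>\<^sub>0_def)
  ultimately show ?thesis by blast
qed

section \<open>Closure properties of features\<close>

lemma feature_const: "feature (\<lambda>y. c)"
  by (rule feature.token[of "\<lambda>_. c"])

lemma feature_diff:
  assumes "feature f" "feature g"
  shows "feature (\<lambda>y. f y - g y)"
  using feature.add[OF assms(1) feature.cmult[OF assms(2), of "-1"]] by simp

lemma feature_minus: "feature f \<Longrightarrow> feature (\<lambda>y. - f y)"
  using feature.cmult[of f "-1"] by simp

text \<open>The gate multiplies by a positive part only; a factor of arbitrary sign is the
  difference of its positive and negative parts.\<close>

lemma feature_mult:
  assumes "feature f" "feature g"
  shows "feature (\<lambda>y. f y * g y)"
proof -
  have "feature (\<lambda>y. f y * max (g y) 0 - f y * max (- 1 * g y) 0)"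
    by (intro feature_diff feature.gate feature.cmult assms)
  moreover have "f y * max (g y) 0 - f y * max (- 1 * g y) 0 = f y * g y" for y
    by (simp add: max_def)
  ultimately show ?thesis by simp
qed

lemma feature_sum:
  assumes "finite I" "\<And>i. i \<in> I \<Longrightarrow> feature (f i)"
  shows "feature (\<lambda>y. \<Sum>i\<in>I. f i y)"
  using assms by (induction I) (simp_all add: feature_const feature.add)

definition int_feature :: "('v list \<Rightarrow> int) \<Rightarrow> bool" where
  "int_feature f \<longleftrightarrow> feature (\<lambda>y. real_of_int (f y))"

definition bool_feature :: "('v list \<Rightarrow> bool) \<Rightarrow> bool" where
  "bool_feature P \<longleftrightarrow> feature (\<lambda>y. of_bool (P y))"

text \<open>A one-hot representation by indicators of level sets, the form in which the logits will
  be produced.\<close>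

definition fin_feature :: "('v list \<Rightarrow> 'f) \<Rightarrow> bool" where
  "fin_feature F \<longleftrightarrow> (\<forall>c. bool_feature (\<lambda>y. F y = c))"

lemma int_feature_cong:
  "int_feature f \<Longrightarrow> (\<And>y. y \<noteq> [] \<Longrightarrow> g y = f y) \<Longrightarrow> int_feature g"
  unfolding int_feature_def by (erule feature.cong) simp

lemma bool_feature_cong:
  "bool_feature P \<Longrightarrow> (\<And>y. y \<noteq> [] \<Longrightarrow> Q y = P y) \<Longrightarrow> bool_feature Q"
  unfolding bool_feature_def by (erule feature.cong) simp

lemma fin_feature_cong:
  assumes "fin_feature F" "\<And>y. y \<noteq> [] \<Longrightarrow> G y = F y"
  shows "fin_feature G"
  unfolding fin_feature_def
proof
  fix c
  have "bool_feature (\<lambda>y. F y = c)"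
    using assms(1) by (simp add: fin_feature_def)
  then show "bool_feature (\<lambda>y. G y = c)"
    by (rule bool_feature_cong) (simp add: assms(2))
qed

lemma int_feature_token: "int_feature (\<lambda>y. f (last y))"
  unfolding int_feature_def by (rule feature.token)

lemma int_feature_const: "int_feature (\<lambda>y. c)"
  unfolding int_feature_def by (rule feature_const)

lemma int_feature_length: "int_feature (\<lambda>y. int (length y))"
  unfolding int_feature_def using feature.length by simp

lemma int_feature_add: "int_feature f \<Longrightarrow> int_feature g \<Longrightarrow> int_feature (\<lambda>y. f y + g y)"
  unfolding int_feature_def by (simp add: feature.add)

lemma int_feature_diff: "int_feature f \<Longrightarrow> int_feature g \<Longrightarrow> int_feature (\<lambda>y. f y - g y)"
  unfolding int_feature_def by (simp add: feature_diff)

lemma int_feature_mult: "int_feature f \<Longrightarrow> int_feature g \<Longrightarrow> int_feature (\<lambda>y. f y * g y)"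
  unfolding int_feature_def by (simp add: feature_mult)

lemma int_feature_minus: "int_feature f \<Longrightarrow> int_feature (\<lambda>y. - f y)"
  using int_feature_diff[OF int_feature_const[of 0]] by simp

lemma bool_feature_not: "bool_feature P \<Longrightarrow> bool_feature (\<lambda>y. \<not> P y)"
  unfolding bool_feature_def using feature_diff[OF feature_const[of 1]] by (simp add: of_bool_not_iff)

lemma bool_feature_conj: "bool_feature P \<Longrightarrow> bool_feature Q \<Longrightarrow> bool_feature (\<lambda>y. P y \<and> Q y)"
  unfolding bool_feature_def by (simp add: feature_mult of_bool_conj)

text \<open>For integers \<open>f - g\<close> is at most 0 or at least 1, so
  \<open>max (1 - max (f - g) 0) 0\<close> takes only the values 1 and 0.\<close>

lemma bool_feature_le:
  assumes "int_feature f" "int_feature g"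
  shows "bool_feature (\<lambda>y. f y \<le> g y)"
proof -
  let ?d = "\<lambda>y. real_of_int (f y) - real_of_int (g y)"
  have "feature (\<lambda>y. 1 * max (1 - 1 * max (?d y) 0) 0)"
    using assms unfolding int_feature_def
    by (intro feature.gate feature_diff feature_const)
  moreover have "1 * max (1 - 1 * max (?d y) 0) 0 = of_bool (f y \<le> g y)" for y
  proof (cases "f y \<le> g y")
    case False
    then have "real_of_int (g y) + 1 \<le> real_of_int (f y)" by linarith
    then show ?thesis using False by simp
  qed simp
  ultimately show ?thesis
    unfolding bool_feature_def by simp
qed

lemma bool_feature_eq:
  assumes "int_feature f" "int_feature g"
  shows "bool_feature (\<lambda>y. f y = g y)"
proof -
  have "bool_feature (\<lambda>y. f y \<le> g y \<and> g y \<le> f y)"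
    by (intro bool_feature_conj bool_feature_le assms)
  then show ?thesis by (simp add: order_eq_iff)
qed

lemma bool_feature_less:
  "int_feature f \<Longrightarrow> int_feature g \<Longrightarrow> bool_feature (\<lambda>y. f y < g y)"
  using bool_feature_not[OF bool_feature_le[of g f]] by (simp add: not_le)

lemma feature_if:
  assumes "bool_feature P" "feature f" "feature g"
  shows "feature (\<lambda>y. if P y then f y else g y)"
proof -
  have "feature (\<lambda>y. of_bool (P y) * f y + of_bool (\<not> P y) * g y)"
    using assms(1) bool_feature_not[OF assms(1)] unfolding bool_feature_def
    by (intro feature.add feature_mult assms(2,3))
  then show ?thesis by (rule feature.cong) simp
qed

lemma int_feature_if:
  "bool_feature P \<Longrightarrow> int_feature f \<Longrightarrow> int_feature g \<Longrightarrow> int_feature (\<lambda>y. if P y then f y else g y)"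
  unfolding int_feature_def by (drule (2) feature_if) (simp add: if_distrib[of real_of_int])

lemma bool_feature_if:
  assumes "bool_feature P" "bool_feature Q" "bool_feature R"
  shows "bool_feature (\<lambda>y. if P y then Q y else R y)"
  using feature_if[OF assms(1) assms(2,3)[unfolded bool_feature_def]]
  unfolding bool_feature_def by (rule feature.cong) simp

lemma fin_feature_if:
  assumes "bool_feature P" "fin_feature F" "fin_feature G"
  shows "fin_feature (\<lambda>y. if P y then F y else G y)"
  unfolding fin_feature_def
proof
  fix c
  have "bool_feature (\<lambda>y. if P y then F y = c else G y = c)"
    using assms by (intro bool_feature_if) (auto simp: fin_feature_def)
  then show "bool_feature (\<lambda>y. (if P y then F y else G y) = c)"
    by (rule bool_feature_cong) simp
qed

lemma fin_feature_const: "fin_feature (\<lambda>y. c)"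
  unfolding fin_feature_def bool_feature_def by (simp add: feature_const)

lemma fin_feature_token: "fin_feature (\<lambda>y. f (last y))"
  unfolding fin_feature_def bool_feature_def using feature.token[of "\<lambda>t. of_bool (f t = _)"] by simp

text \<open>A finite lookup table: in the sum over all pairs of values only the pair actually
  attained contributes.\<close>

lemma fin_feature_comp2:
  fixes F :: "'v list \<Rightarrow> 'f::finite" and G :: "'v list \<Rightarrow> 'g::finite"
  assumes "fin_feature F" "fin_feature G"
  shows "fin_feature (\<lambda>y. h (F y) (G y))"
  unfolding fin_feature_def bool_feature_def
proof
  fix c
  have "feature (\<lambda>y. \<Sum>(a, b)\<in>UNIV. of_bool (h a b = c) * (of_bool (F y = a) * of_bool (G y = b)))"
    using assms unfolding fin_feature_def bool_feature_def split_def
    by (intro feature_sum feature.cmult feature_mult finite) auto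
  moreover have "(\<Sum>(a, b)\<in>UNIV. of_bool (h a b = c) * (of_bool (F y = a) * of_bool (G y = b)))
      = (of_bool (h (F y) (G y) = c) :: real)" for y
  proof -
    have "(\<Sum>(a, b)\<in>UNIV. of_bool (h a b = c) * (of_bool (F y = a) * of_bool (G y = b)))
        = (\<Sum>p\<in>UNIV. if p = (F y, G y) then (of_bool (h (F y) (G y) = c) :: real) else 0)"
      by (intro sum.cong) auto
    then show ?thesis by simp
  qed
  ultimately show "feature (\<lambda>y. of_bool (h (F y) (G y) = c))" by simp
qed

section \<open>Sums, maxima and lookups by attention\<close>

lemma sum_hardmax:
  assumes "finite I" "I \<noteq> {}" "\<And>j. j \<in> argmax_set I s \<Longrightarrow> v j = a"
  shows "(\<Sum>j\<in>I. hardmax I s j * v j) = a"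
proof -
  let ?A = "argmax_set I s"
  have "?A \<subseteq> I"
    by (auto simp: argmax_set_def is_arg_max_def)
  obtain m where "m \<in> I" "\<forall>j\<in>I. s j \<le> s m"
    using assms(1,2) Max_in[of "s ` I"] Max_ge[of "s ` I"] by fastforce
  then have "m \<in> ?A"
    by (auto simp: argmax_set_def is_arg_max_def not_less)
  then have card: "card ?A > 0"
    using \<open>?A \<subseteq> I\<close> assms(1) by (auto simp: card_gt_0_iff intro: finite_subset)
  have "(\<Sum>j\<in>I. hardmax I s j * v j) = (\<Sum>j\<in>?A. hardmax I s j * v j)"
    using \<open>?A \<subseteq> I\<close> assms(1) by (intro sum.mono_neutral_right) (auto simp: hardmax_def)
  also have "\<dots> = (\<Sum>j\<in>?A. a / real (card ?A))"
    using assms(3) by (intro sum.cong) (auto simp: hardmax_def)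
  also have "\<dots> = a"
    using card by simp
  finally show ?thesis .
qed

lemma feature_prefix_sum:
  assumes "feature f"
  shows "feature (\<lambda>y. \<Sum>j\<in>{1..length y}. f (take j y))"
proof -
  have "feature (\<lambda>y. real (length y) * attend (\<lambda>_ _. 0) (\<lambda>_ _. 0) f y)"
    using feature_const by (intro feature_mult feature.length feature.attend assms)
  then show ?thesis
  proof (rule feature.cong)
    fix y :: "'a list" assume "y \<noteq> []"
    have "argmax_set {1..length y} (\<lambda>j. 0) = {1..length y}"
      by (auto simp: argmax_set_def is_arg_max_def)
    then show "(\<Sum>j\<in>{1..length y}. f (take j y)) = real (length y) * attend (\<lambda>_ _. 0) (\<lambda>_ _. 0) f y"
      using \<open>y \<noteq> []\<close> by (simp add: attend_def hardmax_def sum_distrib_left)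
  qed
qed

lemma int_feature_sum_list: "int_feature (\<lambda>y. sum_list (map f y))"
proof -
  have "sum_list (map f y) = (\<Sum>j\<in>{1..length y}. f (last (take j y)))" for y
  proof (induction y rule: rev_induct)
    case (snoc t y)
    have "(\<Sum>j\<in>{1..length y}. f (last (take j (y @ [t])))) = (\<Sum>j\<in>{1..length y}. f (last (take j y)))"
      by (intro sum.cong) auto
    then show ?case using snoc by simp
  qed simp
  then have "real_of_int (sum_list (map f y)) = (\<Sum>j\<in>{1..length y}. real_of_int (f (last (take j y))))" for y
    by simp
  then show ?thesis
    unfolding int_feature_def using feature_prefix_sum[OF feature.token[of "\<lambda>t. real_of_int (f t)"]]
    by simp
qed

text \<open>The value serves as its own score. Maximisers may tie, but all of them carry the
  maximum, so their average is the maximum.\<close>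

lemma int_feature_prefix_Max:
  assumes "int_feature f"
  shows "int_feature (\<lambda>y. Max ((\<lambda>j. f (take j y)) ` {1..length y}))"
proof -
  let ?f = "\<lambda>y. real_of_int (f y)"
  let ?q = "\<lambda>r y. of_bool (r = (0::nat))" and ?\<kappa> = "\<lambda>r y. of_bool (r = (0::nat)) * ?f y"
  have "feature (attend ?q ?\<kappa> ?f)"
    using assms unfolding int_feature_def
    by (intro feature.attend feature.cmult feature_const)
  then show ?thesis
    unfolding int_feature_def
  proof (rule feature.cong)
    fix y :: "'a list" assume "y \<noteq> []"
    let ?I = "{1..length y}" and ?M = "Max ((\<lambda>j. f (take j y)) ` {1..length y})"
    have score: "(\<Sum>r<3. ?q r y * ?\<kappa> r (take j y)) = ?f (take j y)" for j
      by (simp add: eval_nat_numeral)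
    have ne: "?I \<noteq> {}" using \<open>y \<noteq> []\<close> by (cases y) auto
    have "?f (take j y) = real_of_int ?M" if "j \<in> argmax_set ?I (\<lambda>j. ?f (take j y))" for j
    proof -
      have "j \<in> ?I" "\<And>i. i \<in> ?I \<Longrightarrow> f (take i y) \<le> f (take j y)"
        using that by (auto simp: argmax_set_def is_arg_max_def not_less)
      then have "?M = f (take j y)"
        by (intro Max_eqI) auto
      then show ?thesis by simp
    qed
    then show "real_of_int ?M = attend ?q ?\<kappa> ?f y"
      unfolding attend_def score using ne by (intro sum_hardmax[symmetric]) auto
  qed
qed

text \<open>Positions start at 1, so 0 is free to signal that no position qualifies.\<close>

primrec latest :: "(nat \<Rightarrow> bool) \<Rightarrow> nat \<Rightarrow> nat" where
  "latest P 0 = 0"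
| "latest P (Suc n) = (if P (Suc n) then Suc n else latest P n)"

lemma latest_le: "latest P n \<le> n"
  by (induction n) auto

lemma latest_cong: "(\<And>j. 1 \<le> j \<Longrightarrow> j \<le> n \<Longrightarrow> P j = Q j) \<Longrightarrow> latest P n = latest Q n"
  by (induction n) auto

lemma latest_eqI:
  assumes "1 \<le> m" "m \<le> n" "P m" "\<And>j. m < j \<Longrightarrow> j \<le> n \<Longrightarrow> \<not> P j"
  shows "latest P n = m"
  using assms
proof (induction n)
  case (Suc n)
  then show ?case by (cases "m = Suc n") auto
qed simp

lemma latest_eq_0_iff: "latest P n = 0 \<longleftrightarrow> (\<forall>j. 1 \<le> j \<and> j \<le> n \<longrightarrow> \<not> P j)"
  by (induction n) (auto simp: le_Suc_eq)

lemma argmax_set_singleton: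
  assumes "i \<in> I" "\<And>j. j \<in> I \<Longrightarrow> j \<noteq> i \<Longrightarrow> s j < s i"
  shows "argmax_set I s = {i}"
proof -
  have "is_arg_max s (\<lambda>j. j \<in> I) j \<longleftrightarrow> j = i" for j
    using assms unfolding is_arg_max_def by (metis order_less_asym order_less_irrefl)
  then show ?thesis
    unfolding argmax_set_def by auto
qed

text \<open>With \<open>n\<close> the length, the score of \<open>j\<close> is
  \<open>j - 2 * n * D j\<close> up to a term independent of \<open>j\<close>, where
  \<open>D j\<close> is \<open>(g - f)\<close> squared, plus 1 if \<open>P\<close> fails. Expanding
  the square takes the three products that \<open>attend\<close> provides. A mismatch has
  \<open>D j >= 1\<close> and loses to every match, and the latest match wins. Without a match the
  head still selects one position, and testing that position exposes the failure.\<close>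

lemma feature_latest:
  assumes P: "bool_feature P" and g: "int_feature g" and f: "int_feature f"
    and v: "feature v" and w: "feature w"
  shows "feature (\<lambda>y. let j = latest (\<lambda>j. P (take j y) \<and> g (take j y) = f y) (length y)
                      in if j = 0 then w y else v (take j y))"
proof -
  define q :: "nat \<Rightarrow> 'a list \<Rightarrow> real" where "q r y =
    (if r = 0 then 4 * real (length y) * real_of_int (f y)
     else if r = 1 then - 2 * real (length y) else 1)" for r y
  define \<kappa> :: "nat \<Rightarrow> 'a list \<Rightarrow> real" where "\<kappa> r y =
    (if r = 0 then real_of_int (g y)
     else if r = 1 then real_of_int (g y) * real_of_int (g y) + (1 - of_bool (P y))
     else real (length y))" for r y
  have q: "feature (q r)" for r
    unfolding q_def using f unfolding int_feature_def
    by (cases "r = 0"; cases "r = 1") (auto intro!: feature_mult feature_const feature.length feature_minus feature.cmult)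
  have \<kappa>: "feature (\<kappa> r)" for r
    unfolding \<kappa>_def using g P unfolding int_feature_def bool_feature_def
    by (cases "r = 0"; cases "r = 1") (auto intro!: feature_mult feature_const feature.length feature_diff feature.add)
  let ?m = "\<lambda>y j. P (take j y) \<and> g (take j y) = f y"
  let ?R = "\<lambda>y i. (\<forall>u. attend q \<kappa> u y = u (take i y)) \<and> 1 \<le> i \<and>
    (?m y i \<longrightarrow> latest (?m y) (length y) = i) \<and> (\<not> ?m y i \<longrightarrow> latest (?m y) (length y) = 0)"
  have "\<exists>i. ?R y i" if "y \<noteq> []" for y
  proof -
    let ?n = "length y"
    define E where "E j = (g (take j y) - f y) * (g (take j y) - f y)" for j
    define D where "D j = E j + (1 - of_bool (P (take j y)))" for j
    define S where "S j = int j - 2 * int ?n * D j" for j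
    have E: "E j \<ge> 0" "E j = 0 \<longleftrightarrow> g (take j y) = f y" for j
      by (auto simp: E_def)
    have D0: "D j = 0 \<longleftrightarrow> ?m y j" and D1: "D j \<ge> 0" for j
      using E[of j] by (cases "P (take j y)"; simp add: D_def)+
    have score: "(\<Sum>r<3. q r y * \<kappa> r (take j y)) = real_of_int (S j + 2 * int ?n * f y * f y)"
      if "j \<in> {1..?n}" for j
      using that by (simp add: eval_nat_numeral q_def \<kappa>_def S_def D_def E_def min_def algebra_simps)
    have "{1..?n} \<noteq> {}" using \<open>y \<noteq> []\<close> by (cases y) auto
    then obtain i where i: "i \<in> {1..?n}" "Max (S ` {1..?n}) = S i"
      using obtains_MAX[of "{1..?n}" S] by (metis finite_atLeastAtMost)
    have Si: "S j \<le> S i" if "j \<in> {1..?n}" for j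
      unfolding i(2)[symmetric] using that by simp
    \<comment> \<open>Equal scores would make \<open>2 * n\<close> divide a nonzero difference of
      absolute value below \<open>n\<close>; so there are no ties, whether or not a match
      exists.\<close>
    have inj: "j = j'" if "S j = S j'" "j \<in> {1..?n}" "j' \<in> {1..?n}" for j j'
    proof (rule ccontr)
      assume "j \<noteq> j'"
      have "int j - int j' = 2 * int ?n * (D j - D j')"
        using that(1) by (simp add: S_def algebra_simps)
      then have "2 * int ?n dvd int j - int j'" by simp
      then have "2 * int ?n \<le> \<bar>int j - int j'\<bar>"
        using \<open>j \<noteq> j'\<close> by (intro zdvd_imp_le[of _ "\<bar>_\<bar>"]) auto
      then show False using that(2,3) by auto
    qed
    have arg: "argmax_set {1..?n} (\<lambda>j. \<Sum>r<3. q r y * \<kappa> r (take j y)) = {i}"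
    proof (rule argmax_set_singleton[OF i(1)])
      fix j assume j: "j \<in> {1..?n}" "j \<noteq> i"
      then have "S j < S i"
        using Si[OF j(1)] inj[OF _ j(1) i(1)] by force
      then show "(\<Sum>r<3. q r y * \<kappa> r (take j y)) < (\<Sum>r<3. q r y * \<kappa> r (take i y))"
        unfolding score[OF j(1)] score[OF i(1)] by simp
    qed
    have att: "attend q \<kappa> u y = u (take i y)" for u
      unfolding attend_def using i(1) by (intro sum_hardmax) (auto simp only: arg finite_atLeastAtMost)
    \<comment> \<open>A match scores \<open>j >= 1\<close>, whereas \<open>D i >= 1\<close> would
      leave at most \<open>i - 2 * n < 0\<close>.\<close>
    have best: "?m y i \<and> j \<le> i" if j: "j \<in> {1..?n}" "?m y j" for j
    proof -
      have Dj: "D j = 0" using j D0 by simp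
      have le: "int j \<le> int i - 2 * int ?n * D i"
        using Si[OF j(1)] Dj by (simp add: S_def)
      have "D i = 0"
      proof (rule ccontr)
        assume "D i \<noteq> 0"
        then have "D i \<ge> 1" using D1[of i] by simp
        then have "2 * int ?n * 1 \<le> 2 * int ?n * D i"
          by (intro mult_left_mono) auto
        then show False using le i(1) j(1) by auto
      qed
      then show ?thesis using le D0[of i] by simp
    qed
    show ?thesis
    proof (intro exI[of _ i] conjI impI allI att)
      show "1 \<le> i" using i by simp
      show "latest (?m y) ?n = i" if "?m y i"
      proof (rule latest_eqI)
        show "\<not> ?m y j" if "i < j" "j \<le> ?n" for j
          using best[of j] that i(1) by auto
      qed (use that i(1) in auto)
      show "latest (?m y) ?n = 0" if "\<not> ?m y i"
        unfolding latest_eq_0_iff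
      proof (intro allI impI)
        fix j assume "1 \<le> j \<and> j \<le> ?n"
        then show "\<not> ?m y j" using best[of j] that by auto
      qed
    qed
  qed
  then have "\<forall>y. \<exists>i. y \<noteq> [] \<longrightarrow> ?R y i"
    by simp
  from choice[OF this] obtain I where I: "\<forall>y. y \<noteq> [] \<longrightarrow> ?R y (I y)" ..
  \<comment> \<open>The same queries and keys return any feature at \<open>I y\<close>; reading
    \<open>P\<close> and \<open>g\<close> there tells whether the selected position is a
    match.\<close>
  have retrieve: "feature (\<lambda>y. u (take (I y) y))" if "feature u" for u :: "'a list \<Rightarrow> real"
    using feature.attend[of q \<kappa> u, OF q \<kappa> that] by (rule feature.cong) (simp add: I)
  have "bool_feature (\<lambda>y. P (take (I y) y))" "int_feature (\<lambda>y. g (take (I y) y))"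
    using retrieve P g unfolding int_feature_def bool_feature_def by auto
  then have "feature (\<lambda>y. if ?m y (I y) then v (take (I y) y) else w y)"
    by (intro feature_if bool_feature_conj bool_feature_eq f retrieve v w)
  then show ?thesis
  proof (rule feature.cong)
    fix y :: "'a list" assume "y \<noteq> []"
    then show "(let j = latest (?m y) (length y) in if j = 0 then w y else v (take j y))
        = (if ?m y (I y) then v (take (I y) y) else w y)"
      using I[rule_format, of y] 
      by (cases "?m y (I y)") (simp_all add: Let_def del: de_Morgan_conj)
  qed
qed

text \<open>The logits are the indicators of \<open>N y = a\<close>: the value 1 is attained by one
  token only, so the maximum is unique.\<close>

lemma transformer_of_next_token:
  fixes N :: "'v list \<Rightarrow> 'v"
  assumes "finite (UNIV :: 'v set)" and "fin_feature N"
  shows "\<exists>\<theta>. is_transformer \<theta> \<and> (\<forall>y. y \<noteq> [] \<longrightarrow> next_token_defined \<theta> y \<and> next_token \<theta> y = N y)"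
proof -
  obtain \<theta> where \<theta>: "is_transformer \<theta>" "\<And>y a. y \<noteq> [] \<Longrightarrow> logit \<theta> y a = of_bool (N y = a)"
    using transformer_of_features[OF assms(1), of "\<lambda>a y. of_bool (N y = a)"] assms(2)
    unfolding fin_feature_def bool_feature_def by metis
  have "is_arg_max (logit \<theta> y) (\<lambda>_. True) a \<longleftrightarrow> a = N y" if "y \<noteq> []" for y a
    using \<theta>(2)[OF that] by (auto simp: is_arg_max_def)
  then have "next_token_defined \<theta> y \<and> next_token \<theta> y = N y" if "y \<noteq> []" for y
    using that unfolding next_token_defined_def next_token_def arg_max_def by auto
  then show ?thesis using \<theta>(1) by blast
qed

section \<open>The next token\<close>

primrec token_offset :: "('q, 'a) token \<Rightarrow> int" where
  "token_offset (Sym q a m) = offset m"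
| "token_offset SEP = 0"
| "token_offset RETURN = 0"

primrec token_state :: "('q, 'a) token \<Rightarrow> 'q" where
  "token_state (Sym q a m) = q"
| "token_state SEP = undefined"
| "token_state RETURN = undefined"

primrec token_symbol :: "('q, 'a) token \<Rightarrow> 'a" where
  "token_symbol (Sym q a m) = a"
| "token_symbol SEP = undefined"
| "token_symbol RETURN = undefined"

definition head_pos :: "('q, 'a) token list \<Rightarrow> int" where
  "head_pos y = sum_list (map token_offset y)"

text \<open>A token writes before it moves, hence its own offset is taken back.\<close>

definition write_pos :: "('q, 'a) token list \<Rightarrow> int" where
  "write_pos y = head_pos y - token_offset (last y)"

definition rightmost :: "('q, 'a) token list \<Rightarrow> int" where
  "rightmost y = Max ((\<lambda>j. head_pos (take j y)) ` {0..length y})"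

text \<open>A minimum in the form of a negated maximum, because prefix maxima are what attention
  computes; index 0 accounts for the starting cell.\<close>

definition leftmost :: "('q, 'a) token list \<Rightarrow> int" where
  "leftmost y = - Max ((\<lambda>j. - head_pos (take j y)) ` {0..length y})"

definition trace :: "('q, 'a) token list \<Rightarrow> ('q, 'a) token list" where
  "trace y = takeWhile (\<lambda>t. t \<noteq> SEP) y"

text \<open>Prefixes containing \<open>SEP\<close> are excluded, so lookups still refer to the old
  trace while its summary is being generated.\<close>

definition last_write :: "('q, 'a) token list \<Rightarrow> int \<Rightarrow> nat" where
  "last_write y c = latest (\<lambda>j. SEP \<notin> set (take j y) \<and> write_pos (take j y) = c) (length y)"

definition tape_symbol :: "'a \<Rightarrow> ('q, 'a) token list \<Rightarrow> int \<Rightarrow> 'a" where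
  "tape_symbol b y c =
     (let j = last_write y c in if j = 0 then b else token_symbol (last (take j y)))"

text \<open>The walk goes right over the cells from 0 to \<open>w\<close> and then back. Both
  \<open>k = w\<close> and \<open>k = w + 1\<close> give cell \<open>w\<close>, as the move at
  \<open>k = w\<close> is \<open>Stay\<close>; a move to the right there would visit a new cell and
  enlarge the space.\<close>

definition walk_pos :: "int \<Rightarrow> int \<Rightarrow> int" where
  "walk_pos w k = (if k \<le> w then k else 2 * w + 1 - k)"

definition walk_move :: "int \<Rightarrow> int \<Rightarrow> move" where
  "walk_move w k = (if k < w then MoveRight else if k = w then Stay else MoveLeft)"

definition step_token :: "('q, 'a) tm \<Rightarrow> 'q \<Rightarrow> 'a \<Rightarrow> ('q, 'a) token" where
  "step_token M q a = (case delta M (q, a) of (q', a', m) \<Rightarrow> Sym q' a' m)"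

text \<open>The summary of a trace walks over the visited cells from left to right and then back to the
  head position, rewriting every cell by its current content.\<close>

definition next_tok :: "('q, 'a) tm \<Rightarrow> ('q, 'a) token list \<Rightarrow> ('q, 'a) token" where
  "next_tok M y =
     (let T = trace y; q = token_state (last T); l = leftmost T; w = rightmost T - l;
          k = int (length y) - int (length T) - 1
      in if SEP \<notin> set y then
           if 4 * (w + 1) \<le> int (length T) then SEP
           else step_token M q (tape_symbol (blank M) y (head_pos T))
         else if k = w + 1 + (rightmost T - head_pos T) then RETURN
         else Sym q (tape_symbol (blank M) y (l + walk_pos w k)) (walk_move w k))"

section \<open>The next token rule as a feature\<close>

lemma latest_trace: "latest (\<lambda>j. SEP \<notin> set (take j y)) (length y) = length (trace y)"
proof -
  let ?n = "length (trace y)"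
  have no_sep: "SEP \<notin> set (take ?n y)"
    using set_takeWhileD[of SEP "\<lambda>t. t \<noteq> SEP" y] by (auto simp: trace_def simp flip: takeWhile_eq_take)
  have sep: "SEP \<in> set (take j y)" if "?n < j" "j \<le> length y" for j
  proof -
    have "y ! ?n = SEP"
      using nth_length_takeWhile[of "\<lambda>t. t \<noteq> SEP" y] that by (simp add: trace_def)
    then show ?thesis
      using that by (metis in_set_conv_nth length_take min.absorb2 nth_take)
  qed
  show ?thesis
  proof (cases "?n = 0")
    case True
    then show ?thesis using sep by (auto simp: latest_eq_0_iff)
  next
    case False
    then show ?thesis
      using no_sep sep length_takeWhile_le[of "\<lambda>t. t \<noteq> SEP" y]
      by (intro latest_eqI) (auto simp: trace_def Suc_le_eq)
  qed
qed

lemma bool_feature_no_SEP: "bool_feature (\<lambda>y :: ('q, 'a) token list. SEP \<notin> set y)"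
proof -
  have "bool_feature (\<lambda>y :: ('q, 'a) token list. sum_list (map (\<lambda>t. of_bool (t = SEP)) y) = (0 :: int))"
    by (intro bool_feature_eq int_feature_sum_list int_feature_const)
  then show ?thesis
    by (rule bool_feature_cong) (subst sum_list_nonneg_eq_0_iff, auto)
qed

text \<open>Attending to the longest prefix free of \<open>SEP\<close> freezes \<open>f\<close> at
  the trace while the summary grows. The condition \<open>0 = 0\<close> makes the integer comparison
  in \<open>feature_latest\<close> vacuous, and an empty trace yields the constant
  \<open>f []\<close>.\<close>

lemma feature_trace:
  assumes "feature f"
  shows "feature (\<lambda>y. f (trace y))"
proof -
  have "feature (\<lambda>y. let j = latest (\<lambda>j. SEP \<notin> set (take j y) \<and> (0 :: int) = 0) (length y)
      in if j = 0 then f [] else f (take j y))"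
    by (intro feature_latest bool_feature_no_SEP int_feature_const feature_const assms)
  moreover have "take (length (trace y)) y = trace y" for y :: "('a, 'b) token list"
    by (simp add: trace_def takeWhile_eq_take[symmetric])
  then have "(let j = latest (\<lambda>j. SEP \<notin> set (take j y) \<and> (0 :: int) = 0) (length y)
      in if j = 0 then f [] else f (take j y)) = f (trace y)" for y
    by (auto simp: latest_trace Let_def)
  ultimately show ?thesis by simp
qed

lemma int_feature_trace: "int_feature f \<Longrightarrow> int_feature (\<lambda>y. f (trace y))"
  unfolding int_feature_def by (rule feature_trace)

lemma fin_feature_trace: "fin_feature F \<Longrightarrow> fin_feature (\<lambda>y. F (trace y))"
  unfolding fin_feature_def bool_feature_def using feature_trace by blast

lemma int_feature_head_pos: "int_feature head_pos"
  unfolding head_pos_def[abs_def] by (rule int_feature_sum_list)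

lemma int_feature_write_pos: "int_feature write_pos"
  unfolding write_pos_def[abs_def]
  by (intro int_feature_diff int_feature_head_pos int_feature_token)

text \<open>The empty prefix is no position that attention can see; its contribution
  \<open>f []\<close> is a constant and is compared separately.\<close>

lemma int_feature_prefix_Max_0:
  assumes "int_feature f"
  shows "int_feature (\<lambda>y. Max ((\<lambda>j. f (take j y)) ` {0..length y}))"
proof -
  have "int_feature (\<lambda>y. if Max ((\<lambda>j. f (take j y)) ` {1..length y}) \<le> f []
      then f [] else Max ((\<lambda>j. f (take j y)) ` {1..length y}))"
    by (intro int_feature_if bool_feature_le int_feature_prefix_Max int_feature_const assms)
  then show ?thesis
  proof (rule int_feature_cong)
    fix y :: "'a list" assume "y \<noteq> []"
    let ?g = "\<lambda>j. f (take j y)"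
    from \<open>y \<noteq> []\<close> have "{0..length y} = insert 0 {1..length y}" and ne: "{1..length y} \<noteq> {}"
      by (cases y; auto)+
    then have "Max (?g ` {0..length y}) = Max (insert (f []) (?g ` {1..length y}))"
      by simp
    also have "\<dots> = max (f []) (Max (?g ` {1..length y}))"
      using ne by (intro Max_insert) auto
    finally show "Max (?g ` {0..length y})
      = (if Max (?g ` {1..length y}) \<le> f [] then f [] else Max (?g ` {1..length y}))"
      by (simp only: max_def split: if_split) linarith
  qed
qed

lemma int_feature_rightmost: "int_feature rightmost"
  unfolding rightmost_def[abs_def] by (rule int_feature_prefix_Max_0[OF int_feature_head_pos])

lemma int_feature_leftmost: "int_feature leftmost"
  unfolding leftmost_def[abs_def]
  by (intro int_feature_minus int_feature_prefix_Max_0[OF int_feature_minus] int_feature_head_pos)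

text \<open>The queried cell \<open>f y\<close> may depend on the whole context, although the
  symbols come from the trace: during a summary it varies with the number of tokens after
  \<open>SEP\<close>.\<close>

lemma fin_feature_tape_symbol:
  assumes "int_feature f"
  shows "fin_feature (\<lambda>y. tape_symbol b y (f y))"
  unfolding fin_feature_def bool_feature_def
proof
  fix a
  have "feature (\<lambda>y. let j = latest (\<lambda>j. SEP \<notin> set (take j y) \<and> write_pos (take j y) = f y) (length y)
      in if j = 0 then of_bool (b = a) else of_bool (token_symbol (last (take j y)) = a))"
    using feature.token[of "\<lambda>t. of_bool (token_symbol t = a)"]
    by (intro feature_latest bool_feature_no_SEP int_feature_write_pos feature_const assms)
  then show "feature (\<lambda>y. of_bool (tape_symbol b y (f y) = a))"
    by (rule feature.cong) (simp add: tape_symbol_def last_write_def Let_def)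
qed

lemma fin_feature_next_tok: "fin_feature (next_tok M)"
  for M :: "('q::finite, 'a::finite) tm"
proof -
  note ints = int_feature_trace[OF int_feature_length] int_feature_trace[OF int_feature_head_pos]
    int_feature_trace[OF int_feature_leftmost] int_feature_trace[OF int_feature_rightmost]
    int_feature_length int_feature_add int_feature_diff int_feature_const int_feature_mult
  have walk: "int_feature (\<lambda>y. walk_pos (f y) (g y))" if "int_feature f" "int_feature g"
    for f g :: "('q, 'a) token list \<Rightarrow> int"
    unfolding walk_pos_def by (intro int_feature_if bool_feature_le ints that)
  have move: "fin_feature (\<lambda>y. Sym (F y) (G y) (walk_move (f y) (g y)))"
    if "fin_feature F" "fin_feature G" "int_feature f" "int_feature g"
    for f g and F :: "('q, 'a) token list \<Rightarrow> 'q" and G :: "_ \<Rightarrow> 'a"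
  proof -
    have "fin_feature (\<lambda>y. Sym (F y) (G y) m)" for m
      using fin_feature_comp2[OF that(1,2), of "\<lambda>q a. Sym q a m"] .
    then have "fin_feature (\<lambda>y. if g y < f y then Sym (F y) (G y) MoveRight
        else if g y = f y then Sym (F y) (G y) Stay else Sym (F y) (G y) MoveLeft)"
      by (intro fin_feature_if bool_feature_less bool_feature_eq that)
    then show ?thesis by (rule fin_feature_cong) (simp add: walk_move_def)
  qed
  have state: "fin_feature (\<lambda>y :: ('q, 'a) token list. token_state (last (trace y)))"
    using fin_feature_trace[OF fin_feature_token] .
  have step: "fin_feature (\<lambda>y. step_token M (F y) (G y))"
    if "fin_feature F" "fin_feature G"
    for F :: "('q, 'a) token list \<Rightarrow> 'q" and G :: "_ \<Rightarrow> 'a"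
    using fin_feature_comp2[OF that, of "step_token M"] .
  show ?thesis
    unfolding next_tok_def[abs_def] Let_def
    by (intro fin_feature_if bool_feature_no_SEP bool_feature_le bool_feature_eq walk step move
        state fin_feature_const fin_feature_tape_symbol ints)
qed

lemma finite_tokens: "finite (UNIV :: ('q::finite, 'a::finite) token set)"
proof -
  have "(UNIV :: move set) \<subseteq> {MoveLeft, Stay, MoveRight}"
    using move.exhaust by auto
  then have "finite (UNIV :: move set)"
    by (rule finite_subset) simp
  then have fin: "finite ({SEP, RETURN} \<union> (\<lambda>(q, a, m). Sym q a m) ` (UNIV :: ('q \<times> 'a \<times> move) set))"
    by (simp add: finite_prod)
  have "t \<in> {SEP, RETURN} \<union> (\<lambda>(q, a, m). Sym q a m) ` UNIV" for t :: "('q, 'a) token"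
  proof (cases t)
    case (Sym q a m)
    then show ?thesis by (intro UnI2 image_eqI[of _ _ "(q, a, m)"]) simp_all
  qed simp_all
  then show ?thesis
    by (intro finite_subset[OF _ fin]) blast
qed

lemma transformer_next_tok:
  fixes M :: "('q::finite, 'a::finite) tm"
  obtains \<theta> where "is_transformer \<theta>"
    "\<And>y. y \<noteq> [] \<Longrightarrow> next_token_defined \<theta> y" "\<And>y. y \<noteq> [] \<Longrightarrow> next_token \<theta> y = next_tok M y"
  using transformer_of_next_token[OF finite_tokens fin_feature_next_tok[of M]] that by blast

section \<open>Traces\<close>

lemma head_pos_Nil [simp]: "head_pos [] = 0"
  by (simp add: head_pos_def)

lemma head_pos_snoc [simp]: "head_pos (y @ [t]) = head_pos y + token_offset t"
  by (simp add: head_pos_def)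

lemma last_write_snoc:
  "last_write (y @ [t]) c =
     (if SEP \<notin> set (y @ [t]) \<and> head_pos y = c then Suc (length y) else last_write y c)"
proof -
  let ?P = "\<lambda>y j. SEP \<notin> set (take j y) \<and> write_pos (take j y) = c"
  have "latest (?P (y @ [t])) (length y) = latest (?P y) (length y)"
    by (rule latest_cong) simp
  moreover have "write_pos (y @ [t]) = head_pos y"
    by (simp add: write_pos_def)
  ultimately show ?thesis
    unfolding last_write_def by (cases t) (simp_all del: take_append)
qed

lemma tape_symbol_Nil [simp]: "tape_symbol b [] c = b"
  by (simp add: tape_symbol_def last_write_def)

lemma tape_symbol_snoc:
  "tape_symbol b (y @ [t]) c =
     (if SEP \<notin> set (y @ [t]) \<and> head_pos y = c then token_symbol t else tape_symbol b y c)"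
proof -
  have "last_write y c \<le> length y"
    unfolding last_write_def by (rule latest_le)
  then show ?thesis
    unfolding tape_symbol_def last_write_snoc by (simp add: Let_def)
qed

lemma tape_symbol_append_SEP: "tape_symbol b (y @ SEP # u) c = tape_symbol b y c"
proof (induction u rule: rev_induct)
  case Nil
  show ?case using tape_symbol_snoc[of b y SEP c] by simp
next
  case (snoc t u)
  then show ?case using tape_symbol_snoc[of b "y @ SEP # u" t c] by simp
qed

definition visited :: "('q, 'a) token list \<Rightarrow> int set" where
  "visited y = (\<lambda>j. head_pos (take j y)) ` {0..length y}"

lemma visited_Nil [simp]: "visited [] = {0}"
  by (simp add: visited_def)

lemma visited_snoc: "visited (y @ [t]) = insert (head_pos (y @ [t])) (visited y)"
proof -
  have "{0..length (y @ [t])} = insert (Suc (length y)) {0..length y}"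
    by auto
  moreover have "(\<lambda>j. head_pos (take j (y @ [t]))) ` {0..length y} = visited y"
    unfolding visited_def by (intro image_cong) auto
  ultimately show ?thesis
    unfolding visited_def[of "y @ [t]"] by simp
qed

lemma head_pos_visited: "head_pos y \<in> visited y"
  unfolding visited_def by (rule image_eqI[of _ _ "length y"]) auto

lemma token_offset_bounds: "- 1 \<le> token_offset t \<and> token_offset t \<le> 1"
proof (cases t)
  case (Sym q a m)
  then show ?thesis by (cases m) auto
qed auto

text \<open>Moves of at most one cell leave no gaps. The number of visited cells is thereby
  determined by the two extremes, both of which are features.\<close>

lemma visited_interval: "\<exists>l h. l \<le> h \<and> visited y = {l..h}"
proof (induction y rule: rev_induct)
  case Nil
  show ?case by (intro exI[of _ 0]) auto
next
  case (snoc t y)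
  then obtain l h where lh: "l \<le> h" "visited y = {l..h}" by blast
  let ?p = "head_pos (y @ [t])"
  have "l - 1 \<le> ?p" "?p \<le> h + 1"
    using head_pos_visited[of y] token_offset_bounds[of t] lh by auto
  then have "insert ?p {l..h} = {min l ?p..max h ?p}"
    using lh(1) by auto
  then show ?case
    unfolding visited_snoc lh(2) using lh(1) by (intro exI[of _ "min l ?p"] exI[of _ "max h ?p"]) auto
qed

lemma visited_eq: "visited y = {leftmost y..rightmost y}" and leftmost_le: "leftmost y \<le> rightmost y"
proof -
  obtain l h where lh: "l \<le> h" "visited y = {l..h}"
    using visited_interval by blast
  have "rightmost y = Max (visited y)"
    by (simp add: rightmost_def visited_def)
  also have "\<dots> = h"
    unfolding lh(2) using lh(1) by (intro Max_eqI) auto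
  finally have h: "rightmost y = h" .
  have "leftmost y = - Max (uminus ` visited y)"
    by (simp add: leftmost_def visited_def image_image)
  also have "Max (uminus ` visited y) = - l"
    unfolding lh(2) using lh(1) by (intro Max_eqI) auto
  finally show "visited y = {leftmost y..rightmost y}" "leftmost y \<le> rightmost y"
    using lh h by auto
qed

lemma card_visited: "int (card (visited y)) = rightmost y - leftmost y + 1"
  using leftmost_le[of y] by (simp add: visited_eq)

text \<open>Every write happens at the head position of some prefix.\<close>

lemma tape_symbol_unvisited: "c \<notin> visited y \<Longrightarrow> tape_symbol b y c = b"
proof (induction y rule: rev_induct)
  case (snoc t y)
  then show ?case
    using head_pos_visited[of y] by (auto simp: visited_snoc tape_symbol_snoc)
qed simp

lemma trace_no_SEP: "SEP \<notin> set y \<Longrightarrow> trace y = y"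
  unfolding trace_def by (subst takeWhile_eq_all_conv) auto

lemma trace_append_SEP: "SEP \<notin> set y \<Longrightarrow> trace (y @ SEP # u) = y"
  unfolding trace_def by (subst takeWhile_append2) auto

lemma next_tok_no_SEP:
  assumes "SEP \<notin> set T"
  shows "next_tok M T =
    (if 4 * card (visited T) \<le> length T then SEP
     else step_token M (token_state (last T)) (tape_symbol (blank M) T (head_pos T)))"
proof -
  have "4 * (rightmost T - leftmost T + 1) \<le> int (length T) \<longleftrightarrow> 4 * card (visited T) \<le> length T"
    unfolding card_visited[symmetric] by linarith
  then show ?thesis
    using assms unfolding next_tok_def trace_no_SEP[OF assms] Let_def by simp
qed


section \<open>Summaries\<close>

definition summary_token :: "('q, 'a) tm \<Rightarrow> ('q, 'a) token list \<Rightarrow> int \<Rightarrow> ('q, 'a) token" where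
  "summary_token M T k =
     (let w = rightmost T - leftmost T
      in Sym (token_state (last T)) (tape_symbol (blank M) T (leftmost T + walk_pos w k)) (walk_move w k))"

text \<open>One token for each visited cell on the way to the right end, then one for each leftward
  step down to the head.\<close>

definition summary_length :: "('q, 'a) token list \<Rightarrow> nat" where
  "summary_length T = nat (rightmost T - leftmost T + 1 + (rightmost T - head_pos T))"

definition summary :: "('q, 'a) tm \<Rightarrow> ('q, 'a) token list \<Rightarrow> nat \<Rightarrow> ('q, 'a) token list" where
  "summary M T n = map (\<lambda>k. summary_token M T (int k)) [0..<n]"

lemma summary_0 [simp]: "summary M T 0 = []"
  by (simp add: summary_def)

lemma summary_Suc: "summary M T (Suc n) = summary M T n @ [summary_token M T (int n)]"
  by (simp add: summary_def)

lemma length_summary [simp]: "length (summary M T n) = n"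
  by (simp add: summary_def)

lemma summary_only_Sym: "SEP \<notin> set (summary M T n)" "RETURN \<notin> set (summary M T n)"
  by (auto simp: summary_def summary_token_def Let_def)

lemma int_summary_length:
  "int (summary_length T) = rightmost T - leftmost T + 1 + (rightmost T - head_pos T)"
  using head_pos_visited[of T] unfolding visited_eq summary_length_def by simp

lemma summary_length_bounds: "1 \<le> summary_length T" "summary_length T \<le> 2 * card (visited T)"
  using int_summary_length[of T] card_visited[of T] head_pos_visited[of T] unfolding visited_eq
  by auto

lemma next_tok_summary:
  assumes "SEP \<notin> set T"
  shows "next_tok M (T @ SEP # summary M T n) =
    (if n = summary_length T then RETURN else summary_token M T (int n))"
proof -
  have "n = summary_length T \<longleftrightarrow>
      int n = rightmost T - leftmost T + 1 + (rightmost T - head_pos T)"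
    unfolding int_summary_length[symmetric] by simp
  then show ?thesis
    unfolding next_tok_def trace_append_SEP[OF assms] Let_def tape_symbol_append_SEP
    by (simp add: summary_token_def Let_def)
qed

lemma head_pos_summary: "head_pos (summary M T n) = walk_pos (rightmost T - leftmost T) (int n)"
proof (induction n)
  case 0
  show ?case using leftmost_le[of T] by (simp add: walk_pos_def)
next
  case (Suc n)
  then show ?case
    by (auto simp: summary_Suc summary_token_def Let_def walk_pos_def walk_move_def)
qed

lemma tape_symbol_summary:
  "tape_symbol (blank M) (summary M T n) c =
    (if c \<in> (\<lambda>k. walk_pos (rightmost T - leftmost T) (int k)) ` {0..<n}
     then tape_symbol (blank M) T (leftmost T + c) else blank M)"
proof (induction n)
  case (Suc n)
  let ?w = "rightmost T - leftmost T"
  have "SEP \<notin> set (summary M T n @ [summary_token M T (int n)])"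
    using summary_only_Sym(1)[of M T "Suc n"] by (simp add: summary_Suc)
  moreover have "token_symbol (summary_token M T (int n)) =
      tape_symbol (blank M) T (leftmost T + walk_pos ?w (int n))"
    by (simp add: summary_token_def Let_def)
  ultimately show ?case
    unfolding summary_Suc tape_symbol_snoc head_pos_summary Suc.IH
    by (auto simp: atLeast0_lessThan_Suc)
qed simp

lemma visited_summary:
  "visited (summary M T n) = (\<lambda>k. walk_pos (rightmost T - leftmost T) (int k)) ` {0..n}"
proof (induction n)
  case 0
  show ?case using leftmost_le[of T] by (simp add: walk_pos_def)
next
  case (Suc n)
  then show ?case
    using head_pos_summary[of M T "Suc n"] unfolding summary_Suc visited_snoc
    by (simp add: atLeast0_atMost_Suc)
qed

lemma walk_covers:
  assumes "int n \<ge> w + 1"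
  shows "{0..w} \<subseteq> (\<lambda>k. walk_pos w (int k)) ` {0..<n}"
proof
  fix c assume c: "c \<in> {0..w}"
  then show "c \<in> (\<lambda>k. walk_pos w (int k)) ` {0..<n}"
    using assms by (intro image_eqI[of _ _ "nat c"]) (auto simp: walk_pos_def)
qed

lemma last_summary: "0 < n \<Longrightarrow> token_state (last (summary M T n)) = token_state (last T)"
  by (cases n) (simp_all add: summary_Suc summary_token_def Let_def)

lemma head_pos_full_summary: "head_pos (summary M T (summary_length T)) = head_pos T - leftmost T"
  using head_pos_visited[of T]
  by (auto simp: head_pos_summary int_summary_length walk_pos_def visited_eq)

text \<open>Every visited cell is rewritten with its old content; all other cells were blank in the
  old trace and stay blank in the new one.\<close>

lemma tape_symbol_full_summary:
  "tape_symbol (blank M) (summary M T (summary_length T)) c = tape_symbol (blank M) T (leftmost T + c)"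
proof (cases "leftmost T + c \<in> visited T")
  case True
  then have "c \<in> {0..rightmost T - leftmost T}"
    by (auto simp: visited_eq)
  moreover have "{0..rightmost T - leftmost T} \<subseteq>
      (\<lambda>k. walk_pos (rightmost T - leftmost T) (int k)) ` {0..<summary_length T}"
    using head_pos_visited[of T] by (intro walk_covers) (simp add: int_summary_length visited_eq)
  ultimately show ?thesis
    unfolding tape_symbol_summary by auto
next
  case False
  then show ?thesis
    unfolding tape_symbol_summary by (simp add: tape_symbol_unvisited[OF False])
qed

text \<open>The pause at the right end and the bound \<open>2 * w + 1\<close> on the length keep the
  walk inside \<open>{0..w}\<close>, so reductions do not inflate the measured space.\<close>

lemma visited_full_summary:
  "visited (summary M T (summary_length T)) = (\<lambda>z. z - leftmost T) ` visited T"
proof -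
  let ?w = "rightmost T - leftmost T" and ?n = "summary_length T"
  have n: "?w + 1 \<le> int ?n" "int ?n \<le> 2 * ?w + 1"
    using head_pos_visited[of T] by (auto simp: int_summary_length visited_eq)
  have "(\<lambda>k. walk_pos ?w (int k)) ` {0..?n} = {0..?w}"
  proof
    show "{0..?w} \<subseteq> (\<lambda>k. walk_pos ?w (int k)) ` {0..?n}"
      using walk_covers[OF n(1)] by (rule order_trans) (intro image_mono, auto)
    show "(\<lambda>k. walk_pos ?w (int k)) ` {0..?n} \<subseteq> {0..?w}"
      using n(2) by (auto simp: walk_pos_def)
  qed
  also have "{0..?w} = (\<lambda>z. z - leftmost T) ` visited T"
    unfolding visited_eq by (simp add: image_minus_const_atLeastAtMost')
  finally show ?thesis
    unfolding visited_summary .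
qed

section \<open>Simulation\<close>

definition tm_tape :: "('q, 'a) tm \<Rightarrow> 'a list \<Rightarrow> nat \<Rightarrow> int \<Rightarrow> 'a" where
  "tm_tape M x t = fst (snd (tm_config M x t))"

definition tm_visited :: "('q, 'a) tm \<Rightarrow> 'a list \<Rightarrow> nat \<Rightarrow> int set" where
  "tm_visited M x t = {0..<int (length x)} \<union> tm_head M x ` {0..t}"

text \<open>Cell \<open>c\<close> of the trace is cell \<open>c + s\<close> of the machine. Equality
  of the visited sets up to the shift makes the space read off the context the true one.\<close>

definition simulates :: "('q, 'a) tm \<Rightarrow> 'a list \<Rightarrow> nat \<Rightarrow> ('q, 'a) token list \<Rightarrow> int \<Rightarrow> bool" where
  "simulates M x t T s \<longleftrightarrow> T \<noteq> [] \<and> SEP \<notin> set T \<and> RETURN \<notin> set T \<and>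
     token_state (last T) = tm_state M x t \<and>
     (\<forall>c. tape_symbol (blank M) T c = tm_tape M x t (c + s)) \<and>
     head_pos T = tm_head M x t - s \<and>
     visited T = (\<lambda>z. z - s) ` tm_visited M x t"

lemma tm_config_eq: "tm_config M x t = (tm_state M x t, tm_tape M x t, tm_head M x t)"
  by (simp add: tm_state_def tm_tape_def tm_head_def)

lemma tm_config_Suc:
  assumes "step_token M (tm_state M x t) (tm_tape M x t (tm_head M x t)) = tok"
  shows "tm_state M x (Suc t) = token_state tok"
    "tm_tape M x (Suc t) = (tm_tape M x t)(tm_head M x t := token_symbol tok)"
    "tm_head M x (Suc t) = tm_head M x t + token_offset tok"
proof -
  have "tm_config M x (Suc t) = tm_step M (tm_config M x t)"
    by (simp add: tm_config_def)
  also have "\<dots> = (token_state tok, (tm_tape M x t)(tm_head M x t := token_symbol tok),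
      tm_head M x t + token_offset tok)"
    using assms unfolding tm_config_eq[of M x t] step_token_def by (auto split: prod.splits)
  finally show "tm_state M x (Suc t) = token_state tok"
    "tm_tape M x (Suc t) = (tm_tape M x t)(tm_head M x t := token_symbol tok)"
    "tm_head M x (Suc t) = tm_head M x t + token_offset tok"
    by (simp_all add: tm_config_eq)
qed

lemma tm_visited_Suc: "tm_visited M x (Suc t) = insert (tm_head M x (Suc t)) (tm_visited M x t)"
  by (simp add: tm_visited_def atLeast0_atMost_Suc)

lemma finite_tm_visited: "finite (tm_visited M x t)"
  by (simp add: tm_visited_def)

lemma tm_visited_mono: "t \<le> t' \<Longrightarrow> tm_visited M x t \<subseteq> tm_visited M x t'"
  by (auto simp: tm_visited_def)

lemma card_tm_visited_mono: "t \<le> t' \<Longrightarrow> card (tm_visited M x t) \<le> card (tm_visited M x t')"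
  by (intro card_mono finite_tm_visited tm_visited_mono)

lemma simulates_card: "simulates M x t T s \<Longrightarrow> card (visited T) = card (tm_visited M x t)"
  by (simp add: simulates_def card_image inj_on_def)

text \<open>The prompt is itself a trace: a head starting at cell 0 writes the input while moving
  right and ends at cell \<open>length x\<close>, where the machine starts.\<close>

lemma simulates_init:
  assumes "x \<noteq> []"
  shows "simulates M x 0 (encode_prompt M x) 0"
proof -
  have prompt_snoc: "encode_prompt M (x @ [a]) = encode_prompt M x @ [Sym (q0 M) a MoveRight]" for x a
    by (simp add: encode_prompt_def)
  have sep: "SEP \<notin> set (encode_prompt M x)" "RETURN \<notin> set (encode_prompt M x)" for x
    by (auto simp: encode_prompt_def)
  have head: "head_pos (encode_prompt M x) = int (length x)" for x
    by (induction x rule: rev_induct) (simp_all add: prompt_snoc, simp add: encode_prompt_def)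
  have tape: "tape_symbol (blank M) (encode_prompt M x) c
      = (if 0 \<le> c \<and> c < int (length x) then x ! nat c else blank M)" for x c
  proof (induction x rule: rev_induct)
    case Nil
    show ?case by (auto simp: encode_prompt_def)
  next
    case (snoc a x)
    then show ?case
      using sep[of x] by (auto simp: tape_symbol_snoc prompt_snoc head nth_append)
  qed
  have vis: "visited (encode_prompt M x) = {0..int (length x)}" for x
  proof (induction x rule: rev_induct)
    case Nil
    show ?case by (simp add: encode_prompt_def)
  next
    case (snoc a x)
    have "visited (encode_prompt M (x @ [a])) = insert (int (length (x @ [a]))) {0..int (length x)}"
      by (simp add: visited_snoc prompt_snoc snoc.IH head add.commute)
    also have "\<dots> = {0..int (length (x @ [a]))}" by auto
    finally show ?case .
  qed
  have init: "tm_state M x 0 = q0 M" "tm_head M x 0 = int (length x)"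
    "tm_tape M x 0 = (\<lambda>i. if 0 \<le> i \<and> i < int (length x) then x ! nat i else blank M)"
    by (simp_all add: tm_state_def tm_head_def tm_tape_def tm_config_def tm_init_def)
  have "tm_visited M x 0 = {0..int (length x)}"
    by (auto simp: tm_visited_def init)
  moreover have "last (encode_prompt M x) = Sym (q0 M) (last x) MoveRight"
    using assms by (simp add: encode_prompt_def last_map)
  ultimately show ?thesis
    using assms unfolding simulates_def
    by (auto simp: sep head tape vis init) (simp add: encode_prompt_def)
qed

lemma simulates_step:
  assumes "simulates M x t T s"
    and "tok = step_token M (token_state (last T)) (tape_symbol (blank M) T (head_pos T))"
  shows "simulates M x (Suc t) (T @ [tok]) s"
proof -
  have "step_token M (tm_state M x t) (tm_tape M x t (tm_head M x t)) = tok"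
    using assms by (simp add: simulates_def)
  note tm = tm_config_Suc[OF this]
  have "tok \<noteq> SEP" "tok \<noteq> RETURN"
    using assms(2) by (auto simp: step_token_def split: prod.splits)
  then show ?thesis
    using assms(1) unfolding simulates_def
    by (auto simp: tm tape_symbol_snoc visited_snoc tm_visited_Suc)
qed

text \<open>The leftmost visited cell of the old trace becomes the new origin, so shifts add
  up.\<close>

lemma simulates_summary:
  assumes "simulates M x t T s"
  shows "simulates M x t (summary M T (summary_length T)) (s + leftmost T)"
proof -
  have "0 < summary_length T"
    using summary_length_bounds(1)[of T] by linarith
  moreover from this have "summary M T (summary_length T) \<noteq> []"
    by (metis length_summary length_greater_0_conv)
  moreover have "(\<lambda>z. z - leftmost T) ` (\<lambda>z. z - s) ` A = (\<lambda>z. z - (s + leftmost T)) ` A" for A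
    unfolding image_image by (simp add: diff_diff_eq)
  ultimately show ?thesis
    using assms unfolding simulates_def
    by (simp add: summary_only_Sym last_summary tape_symbol_full_summary head_pos_full_summary
        visited_full_summary algebra_simps)
qed

section \<open>The generation process and its cost\<close>

lemma reduce_id: "last y \<noteq> RETURN \<Longrightarrow> reduce y = y"
  by (auto simp: reduce_def reducible_def)

lemma next_tok_neq_RETURN: "SEP \<notin> set T \<Longrightarrow> next_tok M T \<noteq> RETURN"
  by (auto simp: next_tok_no_SEP step_token_def split: prod.splits)

definition halting_tokens :: "('q, 'a) tm \<Rightarrow> ('q, 'a) token set" where
  "halting_tokens M = tokens_of (Q_accept M \<union> Q_reject M)"

lemma Sym_tokens_of: "Sym q a m \<in> tokens_of Qs \<longleftrightarrow> q \<in> Qs"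
  by (auto simp: tokens_of_def)

lemma step_token_tokens_of: "step_token M q a \<in> tokens_of Qs \<longleftrightarrow> token_state (step_token M q a) \<in> Qs"
  by (auto simp: step_token_def Sym_tokens_of split: prod.splits)

locale pencil_run =
  fixes M :: "('q, 'a) tm" and \<pi> :: "('q, 'a) token list \<Rightarrow> ('q, 'a) token" and x :: "'a list"
  assumes next_tok: "y \<noteq> [] \<Longrightarrow> \<pi> y = next_tok M y"
    and nonempty: "x \<noteq> []"
begin

abbreviation run :: "nat \<Rightarrow> ('q, 'a) token list" where
  "run j \<equiv> pencil \<pi> (encode_prompt M x) j"

abbreviation space :: "nat \<Rightarrow> nat" where
  "space t \<equiv> card (tm_visited M x t)"

lemma space_pos: "0 < space t"
  using finite_tm_visited[of M x t] by (auto simp: card_gt_0_iff tm_visited_def)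

lemma run_step:
  assumes "run j = T" "T \<noteq> []" "next_tok M T \<noteq> RETURN"
  shows "run (Suc j) = T @ [next_tok M T]"
  using assms by (simp add: append_next_def next_tok reduce_id)

text \<open>The index counts generated tokens: one for \<open>SEP\<close>, one per summary token,
  one for \<open>RETURN\<close>. Until the last of these, \<open>reduce\<close> does
  nothing.\<close>

lemma run_summary:
  assumes "run j = T" "T \<noteq> []" "SEP \<notin> set T" "4 * card (visited T) \<le> length T"
  shows "k \<le> summary_length T \<Longrightarrow> run (Suc j + k) = T @ SEP # summary M T k"
    and "run (Suc (Suc j + summary_length T)) = summary M T (summary_length T)"
proof -
  let ?n = "summary_length T"
  show *: "run (Suc j + k) = T @ SEP # summary M T k" if "k \<le> ?n" for k
    using that
  proof (induction k)
    case 0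
    have "next_tok M T = SEP"
      using assms by (simp add: next_tok_no_SEP)
    then show ?case
      using run_step[OF assms(1,2)] by simp
  next
    case (Suc k)
    have "next_tok M (T @ SEP # summary M T k) = summary_token M T (int k)"
      using Suc.prems by (simp add: next_tok_summary[OF assms(3)])
    moreover have "\<dots> \<noteq> RETURN"
      by (simp add: summary_token_def Let_def)
    ultimately show ?case
      using run_step[of "Suc j + k"] Suc by (simp add: summary_Suc)
  qed
  have "\<pi> (T @ SEP # summary M T ?n) = RETURN"
    by (simp add: next_tok next_tok_summary[OF assms(3)])
  then have "run (Suc (Suc j + ?n)) = reduce (T @ [SEP] @ summary M T ?n @ [RETURN])"
    unfolding pencil.simps append_next_def *[OF order_refl] by simp
  then show "run (Suc (Suc j + ?n)) = summary M T ?n"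
    using reduce_eq[OF summary_only_Sym] by simp
qed

text \<open>In the potential inequality, \<open>b\<close> is the length of the trace right after the last reduction
  (initially, the length of the prompt), so that \<open>length T - b\<close> machine steps have been simulated
  since then.\<close>

definition phase :: "nat \<Rightarrow> nat \<Rightarrow> ('q, 'a) token list \<Rightarrow> bool" where
  "phase t j T \<longleftrightarrow> run j = T \<and> (\<exists>s. simulates M x t T s) \<and>
     (\<forall>i<j. run i \<noteq> [] \<and> \<pi> (run i) \<notin> halting_tokens M \<and> Suc (length (run i)) \<le> 8 * space t) \<and>
     (\<exists>b. b \<le> 2 * space t \<and> b \<le> length T \<and> j + 2 * length T \<le> 3 * t + 2 * b) \<and>
     length T \<le> 4 * space t"

text \<open>The strict bound excludes a reduction before the first machine step. This matters
  because \<open>q0\<close> may already be accepting or rejecting, and summary tokens carry the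
  current state.\<close>

lemma phase_init: "phase 0 0 (encode_prompt M x)" "length (encode_prompt M x) < 4 * space 0"
proof -
  have sim: "simulates M x 0 (encode_prompt M x) 0"
    by (rule simulates_init[OF nonempty])
  have "{0..<int (length x)} \<subseteq> tm_visited M x 0"
    by (auto simp: tm_visited_def)
  from card_mono[OF finite_tm_visited this] have len: "length (encode_prompt M x) \<le> space 0"
    by (simp add: encode_prompt_def)
  then show "length (encode_prompt M x) < 4 * space 0"
    using space_pos[of 0] by linarith
  show "phase 0 0 (encode_prompt M x)"
    unfolding phase_def using sim len
    by (intro conjI exI[of _ 0] exI[of _ "length (encode_prompt M x)"]) auto
qed

text \<open>If the threshold is reached, one reduction makes room without advancing
  \<open>t\<close>. Its tokens carry the current state and would end the run if that state were
  halting; the hypotheses exclude this, for \<open>t = 0\<close> by excluding the reduction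
  itself.\<close>

lemma phase_reduce:
  assumes "phase t j T" "t = 0 \<Longrightarrow> length T < 4 * space t"
    and "1 \<le> t \<Longrightarrow> tm_state M x t \<notin> Q_accept M \<union> Q_reject M"
  shows "\<exists>j T. phase t j T \<and> length T < 4 * space t"
proof (cases "length T < 4 * space t")
  case True
  then show ?thesis using assms(1) by blast
next
  case False
  let ?n = "summary_length T"
  from assms(1) obtain s b where run: "run j = T" and sim: "simulates M x t T s"
    and past: "\<forall>i<j. run i \<noteq> [] \<and> \<pi> (run i) \<notin> halting_tokens M \<and> Suc (length (run i)) \<le> 8 * space t"
    and b: "b \<le> 2 * space t" "b \<le> length T" "j + 2 * length T \<le> 3 * t + 2 * b"
    and len: "length T \<le> 4 * space t"
    unfolding phase_def by blast
  have T: "T \<noteq> []" "SEP \<notin> set T" "token_state (last T) = tm_state M x t"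
    using sim by (auto simp: simulates_def)
  have card: "card (visited T) = space t"
    by (rule simulates_card[OF sim])
  have long: "4 * card (visited T) \<le> length T"
    using False card by simp
  have state: "token_state (last T) \<notin> Q_accept M \<union> Q_reject M"
    using False assms(2,3) T(3) by (cases "t = 0") auto
  have n: "1 \<le> ?n" "?n \<le> 2 * space t"
    using summary_length_bounds[of T] card by auto
  note summ = run_summary[OF run T(1,2) long]
  let ?ok = "\<lambda>i. run i \<noteq> [] \<and> \<pi> (run i) \<notin> halting_tokens M \<and> Suc (length (run i)) \<le> 8 * space t"
  have "?ok i" if "i < Suc (Suc j + ?n)" for i
  proof -
    have "i < j \<or> i = j \<or> i = Suc j + (i - Suc j) \<and> i - Suc j \<le> ?n"
      using that by arith
    then consider "i < j" | "i = j" | k where "i = Suc j + k" "k \<le> ?n"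
      by blast
    then show ?thesis
    proof cases
      case 1
      then show ?thesis using past by blast
    next
      case 2
      have "next_tok M T = SEP"
        using long T(2) by (simp add: next_tok_no_SEP)
      moreover have "Suc (length T) \<le> 8 * space t"
        using len space_pos[of t] by linarith
      ultimately show ?thesis
        using 2 run T(1) by (simp add: next_tok halting_tokens_def tokens_of_def)
    next
      case 3
      have r: "run i = T @ SEP # summary M T k"
        using summ(1)[OF 3(2)] 3(1) by simp
      have "\<pi> (run i) = RETURN \<or> \<pi> (run i) = summary_token M T (int k)"
        unfolding r by (simp add: next_tok next_tok_summary[OF T(2)])
      then have "\<pi> (run i) \<notin> halting_tokens M"
        using state by (auto simp: halting_tokens_def summary_token_def Let_def Sym_tokens_of)
          (auto simp: tokens_of_def)
      \<comment> \<open>The origin of the factor 8: the trace, \<open>SEP\<close>, the summary and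
        one further token amount to at most \<open>4 * R + 1 + 2 * R + 1\<close> with
        \<open>R = space t\<close>.\<close>
      moreover have "Suc (length (run i)) \<le> 8 * space t"
      proof -
        have "length (run i) = length T + 1 + k"
          unfolding r by simp
        then show ?thesis
          using 3(2) n len space_pos[of t] by linarith
      qed
      ultimately show ?thesis
        using r by simp
    qed
  qed
  \<comment> \<open>Here \<open>length T = 4 * space t\<close> and \<open>b <= 2 * space t\<close>,
    so the potential gives \<open>j + 4 * space t <= 3 * t\<close>, while the reduction costs
    \<open>?n + 2 <= 4 * space t\<close> tokens. The summary length becomes the new
    \<open>b\<close>.\<close>
  moreover have "Suc (Suc j + ?n) + 2 * ?n \<le> 3 * t + 2 * ?n"
    using b n len False space_pos[of t] by linarith
  ultimately have "phase t (Suc (Suc j + ?n)) (summary M T ?n)"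
    unfolding phase_def using simulates_summary[OF sim] summ(2) n
    by (intro conjI exI[of _ ?n]) auto
  moreover have "length (summary M T ?n) < 4 * space t"
    unfolding length_summary using n space_pos[of t] by linarith
  ultimately show ?thesis by blast
qed

text \<open>The first two claims cover the halting step as well. The invariant continues only past a
  nonhalting state, since it records that no halting token has been generated.\<close>

lemma phase_next:
  assumes "phase t j T" "length T < 4 * space t"
  shows "token_state (\<pi> T) = tm_state M x (Suc t)"
    and "\<pi> T \<in> tokens_of Qs \<longleftrightarrow> tm_state M x (Suc t) \<in> Qs"
    and "tm_state M x (Suc t) \<notin> Q_accept M \<union> Q_reject M \<Longrightarrow> phase (Suc t) (Suc j) (T @ [\<pi> T])"
proof -
  from assms(1) obtain s b where run: "run j = T" and sim: "simulates M x t T s"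
    and past: "\<forall>i<j. run i \<noteq> [] \<and> \<pi> (run i) \<notin> halting_tokens M \<and> Suc (length (run i)) \<le> 8 * space t"
    and b: "b \<le> 2 * space t" "b \<le> length T" "j + 2 * length T \<le> 3 * t + 2 * b"
    unfolding phase_def by blast
  have T: "T \<noteq> []" "SEP \<notin> set T"
    using sim by (auto simp: simulates_def)
  have \<pi>: "\<pi> T = step_token M (token_state (last T)) (tape_symbol (blank M) T (head_pos T))"
    using assms(2) simulates_card[OF sim] T by (simp add: next_tok next_tok_no_SEP)
  have sim': "simulates M x (Suc t) (T @ [\<pi> T]) s"
    by (rule simulates_step[OF sim \<pi>])
  then show state: "token_state (\<pi> T) = tm_state M x (Suc t)"
    by (simp add: simulates_def)
  show tok: "\<pi> T \<in> tokens_of Qs \<longleftrightarrow> tm_state M x (Suc t) \<in> Qs" for Qs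
    unfolding state[symmetric] unfolding \<pi> by (rule step_token_tokens_of)
  have mono: "space t \<le> space (Suc t)"
    by (rule card_tm_visited_mono) simp
  have run': "run (Suc j) = T @ [\<pi> T]"
    using run_step[OF run T(1) next_tok_neq_RETURN[OF T(2)]] T(1) by (simp add: next_tok)
  assume "tm_state M x (Suc t) \<notin> Q_accept M \<union> Q_reject M"
  then have "\<pi> T \<notin> halting_tokens M"
    by (simp add: halting_tokens_def tok)
  then have "\<forall>i<Suc j. run i \<noteq> [] \<and> \<pi> (run i) \<notin> halting_tokens M \<and>
      Suc (length (run i)) \<le> 8 * space (Suc t)"
    using past mono run T(1) assms(2) by (auto simp: less_Suc_eq intro: order_trans)
  \<comment> \<open>Both sides grow by 3: on the left one token plus twice one unit of
    length.\<close>
  moreover have "b \<le> 2 * space (Suc t) \<and> b \<le> length (T @ [\<pi> T]) \<and>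
      Suc j + 2 * length (T @ [\<pi> T]) \<le> 3 * Suc t + 2 * b"
    using b mono by auto
  moreover have "length (T @ [\<pi> T]) \<le> 4 * space (Suc t)"
    using assms(2) mono by simp
  ultimately show "phase (Suc t) (Suc j) (T @ [\<pi> T])"
    unfolding phase_def using run' sim' by blast
qed

text \<open>The strict length bound says that the next token is a machine step and not
  \<open>SEP\<close>.\<close>

lemma phase_reachable:
  assumes "\<And>t'. 1 \<le> t' \<Longrightarrow> t' \<le> t \<Longrightarrow> tm_state M x t' \<notin> Q_accept M \<union> Q_reject M"
  shows "\<exists>j T. phase t j T \<and> length T < 4 * space t"
  using assms
proof (induction t)
  case 0
  show ?case using phase_init by blast
next
  case (Suc t)
  then obtain j T where "phase t j T" "length T < 4 * space t"
    by (meson le_Suc_eq)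
  from phase_next(3)[OF this] have "phase (Suc t) (Suc j) (T @ [\<pi> T])"
    using Suc.prems by simp
  then show ?case
    using Suc.prems by (intro phase_reduce) auto
qed

lemma pencil_correct:
  assumes "tm_halts M x"
  shows "pencil_halts M \<pi> (encode_prompt M x)"
    and "\<forall>j<pencil_tokens M \<pi> (encode_prompt M x). run j \<noteq> []"
    and "pencil_accepts M \<pi> (encode_prompt M x) \<longleftrightarrow> tm_accepts M x"
    and "pencil_rejects M \<pi> (encode_prompt M x) \<longleftrightarrow> tm_rejects M x"
    and "pencil_tokens M \<pi> (encode_prompt M x) \<le> 3 * tm_time M x"
    and "pencil_context M \<pi> (encode_prompt M x) \<le> 8 * tm_space M x"
proof -
  let ?y = "encode_prompt M x" and ?H = "Q_accept M \<union> Q_reject M"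
  have halt: "1 \<le> tm_time M x" "tm_state M x (tm_time M x) \<in> ?H"
    using LeastI_ex[OF assms[unfolded tm_halts_def]] unfolding tm_time_def by auto
  then obtain t where t: "tm_time M x = Suc t"
    by (cases "tm_time M x") auto
  have "tm_state M x t' \<notin> ?H" if "1 \<le> t'" "t' \<le> t" for t'
    using not_less_Least[of t' "\<lambda>t. 1 \<le> t \<and> tm_state M x t \<in> ?H"] that t
    unfolding tm_time_def by auto
  from phase_reachable[OF this] obtain j T where ph: "phase t j T" "length T < 4 * space t"
    by blast
  note tok = phase_next(2)[OF ph]
  \<comment> \<open>With \<open>b <= length T\<close> the potential inequality becomes
    \<open>j <= 3 * t\<close>. Token number \<open>j\<close>, counted from 0, is the halting one, so
    \<open>j + 1 <= 3 * Suc t\<close> tokens are generated.\<close>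
  have run: "run j = T" and T: "T \<noteq> []" and j: "j \<le> 3 * t"
    and past: "\<And>i. i < j \<Longrightarrow> run i \<noteq> [] \<and> \<pi> (run i) \<notin> halting_tokens M \<and>
      Suc (length (run i)) \<le> 8 * space t"
    using ph(1) unfolding phase_def by (auto simp: simulates_def)
  have gen: "generated \<pi> ?y j \<in> tokens_of Qs \<longleftrightarrow> tm_state M x (tm_time M x) \<in> Qs" for Qs
    using tok by (simp add: generated_def run t)
  have last: "pencil_last M \<pi> ?y = j"
    unfolding pencil_last_def
  proof (rule Least_equality)
    show "generated \<pi> ?y j \<in> tokens_of ?H"
      using gen halt(2) by simp
    show "j \<le> i" if "generated \<pi> ?y i \<in> tokens_of ?H" for i
      using past[of i] that by (auto simp: generated_def halting_tokens_def not_less[symmetric])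
  qed
  show halts: "pencil_halts M \<pi> ?y"
    unfolding pencil_halts_def using gen halt(2) by blast
  show "\<forall>j<pencil_tokens M \<pi> ?y. run j \<noteq> []"
    using past run T by (auto simp: pencil_tokens_def last less_Suc_eq)
  show "pencil_accepts M \<pi> ?y \<longleftrightarrow> tm_accepts M x" "pencil_rejects M \<pi> ?y \<longleftrightarrow> tm_rejects M x"
    using halts assms by (simp_all add: pencil_accepts_def pencil_rejects_def
        tm_accepts_def tm_rejects_def last gen)
  show "pencil_tokens M \<pi> ?y \<le> 3 * tm_time M x"
    using j by (simp add: pencil_tokens_def last t)
  have space: "space t \<le> tm_space M x" "space 0 \<le> tm_space M x"
    using card_tm_visited_mono[of _ "tm_time M x" M x] t
    unfolding tm_space_def tm_visited_def[of M x "tm_time M x", symmetric] by simp_all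
  have "Suc (length (run i)) \<le> 8 * tm_space M x" if "i < Suc j" for i
  proof (cases "i = j")
    case True
    then show ?thesis using run ph(2) space(1) by simp
  next
    case False
    then show ?thesis using past[of i] that space(1) by simp
  qed
  moreover have "length ?y \<le> 8 * tm_space M x"
    using phase_init(2) space(2) by simp
  ultimately show "pencil_context M \<pi> ?y \<le> 8 * tm_space M x"
    unfolding pencil_context_def pencil_tokens_def last append_next_def
    by (intro Max.boundedI) auto
qed

end

theorem theoremG1:
  fixes M :: "('q::finite, 'a::finite) tm"
  assumes "turing_machine M"
  shows "\<exists>(\<theta> :: ('q, 'a) token transformer) (C\<^sub>T :: real) (C\<^sub>S :: real).
    is_transformer \<theta> \<and>
    (\<forall>x. x \<noteq> [] \<and> blank M \<notin> set x \<and> tm_halts M x \<longrightarrow>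
      pencil_halts M (next_token \<theta>) (encode_prompt M x) \<and>
      (\<forall>j < pencil_tokens M (next_token \<theta>) (encode_prompt M x).
         next_token_defined \<theta> (pencil (next_token \<theta>) (encode_prompt M x) j)) \<and>
      (pencil_accepts M (next_token \<theta>) (encode_prompt M x) \<longleftrightarrow> tm_accepts M x) \<and>
      (pencil_rejects M (next_token \<theta>) (encode_prompt M x) \<longleftrightarrow> tm_rejects M x) \<and>
      real (pencil_tokens M (next_token \<theta>) (encode_prompt M x)) \<le> C\<^sub>T * real (tm_time M x) \<and>
      real (pencil_context M (next_token \<theta>) (encode_prompt M x)) \<le> C\<^sub>S * real (tm_space M x))"
proof -
  obtain \<theta> :: "('q, 'a) token transformer" where \<theta>: "is_transformer \<theta>"
      "\<And>y. y \<noteq> [] \<Longrightarrow> next_token_defined \<theta> y" "\<And>y. y \<noteq> [] \<Longrightarrow> next_token \<theta> y = next_tok M y"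
    using transformer_next_tok by blast
  have run: "pencil_run M (next_token \<theta>) x" if "x \<noteq> []" for x
    using \<theta>(3) that by unfold_locales
  show ?thesis
  proof (rule exI[of _ \<theta>], rule exI[of _ 3], rule exI[of _ 8], intro conjI allI impI \<theta>(1); elim conjE)
    fix x assume x: "x \<noteq> []" "tm_halts M x"
    note correct = pencil_run.pencil_correct[OF run[OF x(1)] x(2)]
    show "pencil_halts M (next_token \<theta>) (encode_prompt M x)"
      "pencil_accepts M (next_token \<theta>) (encode_prompt M x) \<longleftrightarrow> tm_accepts M x"
      "pencil_rejects M (next_token \<theta>) (encode_prompt M x) \<longleftrightarrow> tm_rejects M x"
      by (fact correct)+
    show "next_token_defined \<theta> (pencil (next_token \<theta>) (encode_prompt M x) j)"
      if "j < pencil_tokens M (next_token \<theta>) (encode_prompt M x)" for j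
      using correct(2) that \<theta>(2) by blast
    show "real (pencil_tokens M (next_token \<theta>) (encode_prompt M x)) \<le> 3 * real (tm_time M x)"
      using correct(5) by linarith
    show "real (pencil_context M (next_token \<theta>) (encode_prompt M x)) \<le> 8 * real (tm_space M x)"
      using correct(6) by linarith
  qed
qed

end
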